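(* Let $\mathcal G$ be a connected groupoid, $x\in\mathcal G_0$, $\tau(x)=\{\tau_y\}_{y\in\mathcal G_0}$ a transversal for $x$, $A$ a ring, $\gamma=(I,\gamma_{\tau(x)},\gamma_{(x)})\in\mathcal D_{\tau(x)}(A)$ a datum, and $\beta=(B_g,\beta_g)_{g\in\mathcal G}$ the lifted partial action of $\mathcal G$ on $A$ coming from $\gamma$. If $\gamma$ is globalizable and $\tilde\gamma=(J,\tilde\gamma_{\tau(x)},\tilde\gamma_{(x)})$ is a globalization of $\gamma$ in a ring $B$, then the groupoid action $\tilde\beta=(\tilde B_g,\tilde\beta_g)_{g\in\mathcal G}$ of $\mathcal G$ on $B$ given by $$\tilde B_g=J_{t(g)},\qquad \tilde\beta_g=\tilde\gamma_{\tau_{t(g)}}\circ\tilde\gamma_{g_x}\circ\tilde\gamma_{\tau_{s(g)}}^{-1}:J_{s(g)}\to J_{t(g)}\qquad(g\in\mathcal G)$$ is a globalization of $\beta$.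
   Context: Conventions. Rings are associative, not necessarily unital; ideals are two-sided. A groupoid $\mathcal G$ is a small category in which every morphism is invertible; it is identified with its set of morphisms, and its set of objects $\mathcal G_0$ is identified with the set of identity morphisms. For $g\in\mathcal G$, $s(g)=g^{-1}g$ and $t(g)=gg^{-1}$; $gh$ is defined iff $s(g)=t(h)$. Put $\mathcal G(y,z)=\{g: s(g)=y,\ t(g)=z\}$ and $\mathcal G(x)=\mathcal G(x,x)$ (a group). $\mathcal G$ is connected if $\mathcal G(y,z)\neq\emptyset$ for all $y,z\in\mathcal G_0$. A transversal for $x$ is a family $\tau(x)=\{\tau_y: y\in\mathcal G_0\}$ with $\tau_y\in\mathcal G(x,y)$ and $\tau_x=x$. Put $g_x=\tau_{t(g)}^{-1}g\tau_{s(g)}\in\mathcal G(x)$. For partial bijections, $u\circ v$ has domain $v^{-1}(\mathrm{dom}(u)\cap\mathrm{ran}(v))$ and range $u(\mathrm{dom}(u)\cap\mathrm{ran}(v))$; $u\le v$ means $v$ extends $u$. A partial action of a groupoid $\mathcal G$ on a ring $A$ is a family $\alpha=(A_g,\alpha_g)_{g\in\mathcal G}$ where, for each $g$, $A_{t(g)}$ is an ideal of $A$, $A_g$ is an ideal of $A_{t(g)}$, $\alpha_g:A_{g^{-1}}\to A_g$ is a ring isomorphism, $\alpha_y=\mathrm{id}_{A_y}$ for $y\in\mathcal G_0$, and $\alpha_g\alpha_h\le\alpha_{gh}$ whenever $s(g)=t(h)$. It is global (a groupoid action) if $\alpha_g\alpha_h=\alpha_{gh}$ whenever $s(g)=t(h)$;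 equivalently $A_g=A_{t(g)}$ for all $g$. A partial action of a group $H$ on a ring $R$ is the one-object case with the ideal attached to the identity equal to $R$. A globalization of a partial action $\alpha=(A_g,\alpha_g)_{g\in\mathcal G}$ of $\mathcal G$ on $A$ is a pair $(\tilde A,\tilde\alpha)$ with $\tilde A$ a ring and $\tilde\alpha=(\tilde A_g,\tilde\alpha_g)_{g\in\mathcal G}$ a global action of $\mathcal G$ on $\tilde A$ such that: $A_y$ is an ideal of $\tilde A_y$ for all $y\in\mathcal G_0$; $A_g=A_{t(g)}\cap\tilde\alpha_g(A_{s(g)})$ for all $g\in\mathcal G$; $\tilde\alpha_g(a)=\alpha_g(a)$ for all $a\in A_{g^{-1}}$, $g\in\mathcal G$; and $\tilde A_g=\sum_{t(h)=t(g)}\tilde\alpha_h(A_{s(h)})$ for all $g\in\mathcal G$. A globalization of a partial group action of $H$ on $R$ is the one-object case: a ring $\tilde R$ with $R$ as an ideal and a global action $\tilde\alpha$ of $H$ on $\tilde R$ by automorphisms with $R_h=R\cap\tilde\alpha_h(R)$, $\tilde\alpha_h|_{R_{h^{-1}}}=\alpha_h$ and $\tilde R=\sum_{h\in H}\tilde\alpha_h(R)$. An object of $\mathcal D_{\tau(x)}(A)$ is a datum $(I,\gamma_{\tau(x)},\gamma_{(x)})$ consisting of: (a) a family $I=\{I_y\}_{y\in\mathcal G_0}$ of ideals of $A$; (b) ring isomorphisms $\gamma_{\tau(x)}=\{\gamma_{\tau_y}:I_{\tau_y^{-1}}\to I_{\tau_y}\}_{y\in\mathcal G_0}$; (c) a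 partial action $\gamma_{(x)}=(I_h,\gamma_h)_{h\in\mathcal G(x)}$ of the group $\mathcal G(x)$ on $I_x$; such that (d) $\gamma_x=\gamma_{\tau_x}$ is the identity map of $I_x=I_{\tau_x}$; (e) $I_{\tau_y}$ is an ideal of $I_y$ and $I_{\tau_y^{-1}}$ is an ideal of $I_x$ for all $y$; (f) $\gamma_{\tau_{t(g)}}\big(I_{\tau_{t(g)}^{-1}}\cap\gamma_{g_x}(I_{\tau_{s(g)}^{-1}}\cap I_{g_x^{-1}})\big)$ is an ideal of $I_{t(g)}$ for all $g\in\mathcal G$. The lifted partial action coming from it is $\beta=(B_g,\beta_g)_{g\in\mathcal G}$ with $\beta_y=\mathrm{id}_{I_y}$ for $y\in\mathcal G_0$, $\beta_g=\gamma_{\tau_{t(g)}}\circ\gamma_{g_x}\circ\gamma_{\tau_{s(g)}}^{-1}$ for $g\notin\mathcal G_0$ (composition of partial bijections), and $B_g$ the range of $\beta_g$; it is a partial action of $\mathcal G$ on $A$. The datum $\gamma=(I,\gamma_{\tau(x)},\gamma_{(x)})$ is globalizable if: (1) $I_x$ is a unital ring and the partial group action $\gamma_{(x)}$ of $\mathcal G(x)$ on $I_x$ admits a globalization $(J_x,\tilde\gamma_{(x)})$, $\tilde\gamma_{(x)}=(\tilde\gamma_h)_{h\in\mathcal G(x)}$; (2) there are a ring $B$, a family of ideals $\{J_y\}_{y\in\mathcal G_0}$ of $B$ (with $J_x$ the ring in (1)) and ring isomorphisms $\{\tilde\gamma_{\tau_y}:J_x\to J_y\}_{y\in\mathcal G_0}$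 such that $I_y$ is an ideal of $J_y$ and $\tilde\gamma_{\tau_y}(a)=\gamma_{\tau_y}(a)$ for all $a\in I_{\tau_y^{-1}}$, $y\in\mathcal G_0$; (3) $I_{\tau_y^{-1}}=I_x$ and $I_{\tau_y}=I_y$ for all $y\in\mathcal G_0$. In this case, with $J=\{J_y\}_{y\in\mathcal G_0}$ and $\tilde\gamma_{\tau(x)}=\{\tilde\gamma_{\tau_y}\}_{y\in\mathcal G_0}$, the triple $\tilde\gamma=(J,\tilde\gamma_{\tau(x)},\tilde\gamma_{(x)})$ is called a globalization of $\gamma$ in $B$. *)

theory Defs
  imports "HOL-Algebra.AbelCoset"
begin

section \<open>Rings without unit\<close>

text \<open>The ring records of \<^theory>\<open>HOL-Algebra.Ring\<close> are used, but the field \<open>one\<close> carries no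
  meaning here. A subset \<open>S\<close> of a ring \<open>R\<close> is turned into a ring by \<open>R\<lparr>carrier := S\<rparr>\<close>.\<close>

definition rng :: "('a, 'b) ring_scheme \<Rightarrow> bool" where
  "rng R \<longleftrightarrow> abelian_group R \<and>
    (\<forall>a\<in>carrier R. \<forall>b\<in>carrier R. a \<otimes>\<^bsub>R\<^esub> b \<in> carrier R) \<and>
    (\<forall>a\<in>carrier R. \<forall>b\<in>carrier R. \<forall>c\<in>carrier R.
       (a \<otimes>\<^bsub>R\<^esub> b) \<otimes>\<^bsub>R\<^esub> c = a \<otimes>\<^bsub>R\<^esub> (b \<otimes>\<^bsub>R\<^esub> c) \<and>
       (a \<oplus>\<^bsub>R\<^esub> b) \<otimes>\<^bsub>R\<^esub> c = a \<otimes>\<^bsub>R\<^esub> c \<oplus>\<^bsub>R\<^esub> b \<otimes>\<^bsub>R\<^esub> c \<and>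
       c \<otimes>\<^bsub>R\<^esub> (a \<oplus>\<^bsub>R\<^esub> b) = c \<otimes>\<^bsub>R\<^esub> a \<oplus>\<^bsub>R\<^esub> c \<otimes>\<^bsub>R\<^esub> b)"

definition rng_ideal :: "'a set \<Rightarrow> ('a, 'b) ring_scheme \<Rightarrow> bool" where
  "rng_ideal S R \<longleftrightarrow> rng R \<and> additive_subgroup S R \<and>
    (\<forall>a\<in>S. \<forall>r\<in>carrier R. r \<otimes>\<^bsub>R\<^esub> a \<in> S \<and> a \<otimes>\<^bsub>R\<^esub> r \<in> S)"

definition unital_rng :: "('a, 'b) ring_scheme \<Rightarrow> bool" where
  "unital_rng R \<longleftrightarrow> (\<exists>e. ring (R\<lparr>one := e\<rparr>))"

text \<open>A ring \<open>S\<close>, with operations of its own, is an ideal of the ring \<open>R\<close>. In a globalization, the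
  smaller ring has the operations of \<open>A\<close> and the larger one those of another ring, so their
  agreement has to be required.\<close>

definition is_ideal_of :: "('a, 'b) ring_scheme \<Rightarrow> ('a, 'c) ring_scheme \<Rightarrow> bool" where
  "is_ideal_of S R \<longleftrightarrow> rng S \<and> rng_ideal (carrier S) R \<and>
    (\<forall>a\<in>carrier S. \<forall>b\<in>carrier S.
       a \<oplus>\<^bsub>S\<^esub> b = a \<oplus>\<^bsub>R\<^esub> b \<and> a \<otimes>\<^bsub>S\<^esub> b = a \<otimes>\<^bsub>R\<^esub> b)"

definition ideal_sum :: "('a, 'b) ring_scheme \<Rightarrow> 'i set \<Rightarrow> ('i \<Rightarrow> 'a set) \<Rightarrow> 'a set" where
  "ideal_sum R K F = {finsum R f S | S f. finite S \<and> S \<subseteq> K \<and> (\<forall>i\<in>S. f i \<in> F i)}"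


section \<open>Partial bijections\<close>

text \<open>Partial bijections are partial maps \<open>'a \<rightharpoonup> 'a\<close>: the composition \<open>u \<circ> v\<close> is \<open>u \<circ>\<^sub>m v\<close>, the
  relation \<open>u \<le> v\<close> is \<open>u \<subseteq>\<^sub>m v\<close>, and the identity map of a set \<open>S\<close> is \<open>Some |` S\<close>.\<close>

definition pinv :: "('a \<rightharpoonup> 'b) \<Rightarrow> ('b \<rightharpoonup> 'a)" where
  "pinv m = (\<lambda>b. if b \<in> ran m then Some (THE a. m a = Some b) else None)"

definition pimage :: "('a \<rightharpoonup> 'b) \<Rightarrow> 'a set \<Rightarrow> 'b set" where
  "pimage m S = ran (m |` S)"

definition rng_isom :: "('a \<rightharpoonup> 'b) \<Rightarrow> ('a, 'c) ring_scheme \<Rightarrow> ('b, 'd) ring_scheme \<Rightarrow> bool" where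
  "rng_isom m R S \<longleftrightarrow> dom m = carrier R \<and> ran m = carrier S \<and> inj_on m (dom m) \<and>
    (\<forall>a b a' b'. m a = Some a' \<longrightarrow> m b = Some b' \<longrightarrow>
       m (a \<oplus>\<^bsub>R\<^esub> b) = Some (a' \<oplus>\<^bsub>S\<^esub> b') \<and>
       m (a \<otimes>\<^bsub>R\<^esub> b) = Some (a' \<otimes>\<^bsub>S\<^esub> b'))"


section \<open>Groupoids\<close>

text \<open>The carrier is the set of morphisms, and objects are identified with identity morphisms. The
  product \<open>g \<cdot> h\<close> is meaningful only if \<open>src g = tgt h\<close>.\<close>

record 'g arrows = "'g partial_object" +
  src :: "'g \<Rightarrow> 'g"
  tgt :: "'g \<Rightarrow> 'g"
  cmp :: "'g \<Rightarrow> 'g \<Rightarrow> 'g"  (infixl \<open>\<cdot>\<index>\<close> 70)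

locale groupoid =
  fixes G (structure)
  assumes src_closed: "g \<in> carrier G \<Longrightarrow> src G g \<in> carrier G"
    and tgt_closed: "g \<in> carrier G \<Longrightarrow> tgt G g \<in> carrier G"
    and src_src: "g \<in> carrier G \<Longrightarrow> src G (src G g) = src G g"
    and tgt_src: "g \<in> carrier G \<Longrightarrow> tgt G (src G g) = src G g"
    and src_tgt: "g \<in> carrier G \<Longrightarrow> src G (tgt G g) = tgt G g"
    and tgt_tgt: "g \<in> carrier G \<Longrightarrow> tgt G (tgt G g) = tgt G g"
    and cmp_closed: "\<lbrakk>g \<in> carrier G; h \<in> carrier G; src G g = tgt G h\<rbrakk> \<Longrightarrow> g \<cdot> h \<in> carrier G"
    and src_cmp: "\<lbrakk>g \<in> carrier G; h \<in> carrier G; src G g = tgt G h\<rbrakk> \<Longrightarrow> src G (g \<cdot> h) = src G h"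
    and tgt_cmp: "\<lbrakk>g \<in> carrier G; h \<in> carrier G; src G g = tgt G h\<rbrakk> \<Longrightarrow> tgt G (g \<cdot> h) = tgt G g"
    and cmp_assoc: "\<lbrakk>g \<in> carrier G; h \<in> carrier G; k \<in> carrier G;
          src G g = tgt G h; src G h = tgt G k\<rbrakk> \<Longrightarrow> (g \<cdot> h) \<cdot> k = g \<cdot> (h \<cdot> k)"
    and cmp_src: "g \<in> carrier G \<Longrightarrow> g \<cdot> src G g = g"
    and tgt_cmp_self: "g \<in> carrier G \<Longrightarrow> tgt G g \<cdot> g = g"
    and inverse_ex: "g \<in> carrier G \<Longrightarrow>
          \<exists>h\<in>carrier G. src G h = tgt G g \<and> tgt G h = src G g \<and>
            h \<cdot> g = src G g \<and> g \<cdot> h = tgt G g"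

definition ginv :: "('g, 'm) arrows_scheme \<Rightarrow> 'g \<Rightarrow> 'g" where
  "ginv G g = (THE h. h \<in> carrier G \<and> src G h = tgt G g \<and> tgt G h = src G g \<and>
     h \<cdot>\<^bsub>G\<^esub> g = src G g \<and> g \<cdot>\<^bsub>G\<^esub> h = tgt G g)"

definition objs :: "('g, 'm) arrows_scheme \<Rightarrow> 'g set" where
  "objs G = {y \<in> carrier G. src G y = y \<and> tgt G y = y}"

definition mors :: "('g, 'm) arrows_scheme \<Rightarrow> 'g \<Rightarrow> 'g \<Rightarrow> 'g set" where
  "mors G y z = {g \<in> carrier G. src G g = y \<and> tgt G g = z}"

text \<open>The isotropy group at \<open>x\<close>, as a groupoid with \<open>x\<close> as its only object.\<close>

definition isotropy :: "('g, 'm) arrows_scheme \<Rightarrow> 'g \<Rightarrow> ('g, 'm) arrows_scheme" where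
  "isotropy G x = G\<lparr>carrier := mors G x x\<rparr>"

definition connected_groupoid :: "('g, 'm) arrows_scheme \<Rightarrow> bool" where
  "connected_groupoid G \<longleftrightarrow> (\<forall>y\<in>objs G. \<forall>z\<in>objs G. mors G y z \<noteq> {})"

definition transversal :: "('g, 'm) arrows_scheme \<Rightarrow> 'g \<Rightarrow> ('g \<Rightarrow> 'g) \<Rightarrow> bool" where
  "transversal G x \<tau> \<longleftrightarrow> (\<forall>y\<in>objs G. \<tau> y \<in> mors G x y) \<and> \<tau> x = x"

definition loop_at :: "('g, 'm) arrows_scheme \<Rightarrow> ('g \<Rightarrow> 'g) \<Rightarrow> 'g \<Rightarrow> 'g" where
  "loop_at G \<tau> g = ginv G (\<tau> (tgt G g)) \<cdot>\<^bsub>G\<^esub> g \<cdot>\<^bsub>G\<^esub> \<tau> (src G g)"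


section \<open>Partial actions and globalizations\<close>

definition partial_action ::
  "('g, 'm) arrows_scheme \<Rightarrow> ('a, 'b) ring_scheme \<Rightarrow> ('g \<Rightarrow> 'a set) \<Rightarrow> ('g \<Rightarrow> 'a \<rightharpoonup> 'a) \<Rightarrow> bool" where
  "partial_action G A D \<alpha> \<longleftrightarrow> rng A \<and>
    (\<forall>g\<in>carrier G.
       rng_ideal (D (tgt G g)) A \<and>
       rng_ideal (D g) (A\<lparr>carrier := D (tgt G g)\<rparr>) \<and>
       rng_isom (\<alpha> g) (A\<lparr>carrier := D (ginv G g)\<rparr>) (A\<lparr>carrier := D g\<rparr>)) \<and>
    (\<forall>y\<in>objs G. \<alpha> y = Some |` D y) \<and>
    (\<forall>g\<in>carrier G. \<forall>h\<in>carrier G. src G g = tgt G h \<longrightarrow> \<alpha> g \<circ>\<^sub>m \<alpha> h \<subseteq>\<^sub>m \<alpha> (g \<cdot>\<^bsub>G\<^esub> h))"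

definition global_action ::
  "('g, 'm) arrows_scheme \<Rightarrow> ('a, 'b) ring_scheme \<Rightarrow> ('g \<Rightarrow> 'a set) \<Rightarrow> ('g \<Rightarrow> 'a \<rightharpoonup> 'a) \<Rightarrow> bool" where
  "global_action G A D \<alpha> \<longleftrightarrow> partial_action G A D \<alpha> \<and>
    (\<forall>g\<in>carrier G. \<forall>h\<in>carrier G. src G g = tgt G h \<longrightarrow> \<alpha> g \<circ>\<^sub>m \<alpha> h = \<alpha> (g \<cdot>\<^bsub>G\<^esub> h))"

definition globalization ::
  "('g, 'm) arrows_scheme \<Rightarrow> ('a, 'b) ring_scheme \<Rightarrow> ('g \<Rightarrow> 'a set) \<Rightarrow> ('g \<Rightarrow> 'a \<rightharpoonup> 'a) \<Rightarrow>
   ('a, 'c) ring_scheme \<Rightarrow> ('g \<Rightarrow> 'a set) \<Rightarrow> ('g \<Rightarrow> 'a \<rightharpoonup> 'a) \<Rightarrow> bool" where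
  "globalization G A D \<alpha> A' D' \<alpha>' \<longleftrightarrow>
    partial_action G A D \<alpha> \<and> global_action G A' D' \<alpha>' \<and>
    (\<forall>y\<in>objs G. is_ideal_of (A\<lparr>carrier := D y\<rparr>) (A'\<lparr>carrier := D' y\<rparr>)) \<and>
    (\<forall>g\<in>carrier G. D g = D (tgt G g) \<inter> pimage (\<alpha>' g) (D (src G g))) \<and>
    (\<forall>g\<in>carrier G. \<forall>a\<in>D (ginv G g). \<alpha>' g a = \<alpha> g a) \<and>
    (\<forall>g\<in>carrier G. D' g =
       ideal_sum A' {h \<in> carrier G. tgt G h = tgt G g} (\<lambda>h. pimage (\<alpha>' h) (D (src G h))))"

text \<open>Groups are groupoids with one object.\<close>

definition group_partial_action ::
  "('g, 'm) arrows_scheme \<Rightarrow> ('a, 'b) ring_scheme \<Rightarrow> ('g \<Rightarrow> 'a set) \<Rightarrow> ('g \<Rightarrow> 'a \<rightharpoonup> 'a) \<Rightarrow> bool" where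
  "group_partial_action H R D \<alpha> \<longleftrightarrow>
    (\<exists>e. objs H = {e} \<and> D e = carrier R) \<and> partial_action H R D \<alpha>"

definition group_globalization ::
  "('g, 'm) arrows_scheme \<Rightarrow> ('a, 'b) ring_scheme \<Rightarrow> ('g \<Rightarrow> 'a set) \<Rightarrow> ('g \<Rightarrow> 'a \<rightharpoonup> 'a) \<Rightarrow>
   ('a, 'c) ring_scheme \<Rightarrow> ('g \<Rightarrow> 'a \<rightharpoonup> 'a) \<Rightarrow> bool" where
  "group_globalization H R D \<alpha> R' \<alpha>' \<longleftrightarrow>
    group_partial_action H R D \<alpha> \<and> globalization H R D \<alpha> R' (\<lambda>_. carrier R') \<alpha>'"


section \<open>Data over a transversal and their lifts\<close>

text \<open>The single family \<open>I\<close> holds all ideals of a datum: \<open>I y\<close> for objects \<open>y\<close>, \<open>I (\<tau> y)\<close> and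
  \<open>I (ginv G (\<tau> y))\<close> for the ranges and domains of the maps \<open>\<gamma>\<tau> y\<close>, and \<open>I h\<close> for \<open>h\<close> in the
  isotropy group of \<open>x\<close>. The only overlap of these indices is at \<open>x = \<tau> x\<close>. The map written
  \<open>\<gamma>\<close> with index \<open>\<tau> y\<close> in the mathematics is \<open>\<gamma>\<tau> y\<close>, indexed by the object \<open>y\<close>.\<close>

definition datum ::
  "('g, 'm) arrows_scheme \<Rightarrow> 'g \<Rightarrow> ('g \<Rightarrow> 'g) \<Rightarrow> ('a, 'b) ring_scheme \<Rightarrow>
   ('g \<Rightarrow> 'a set) \<Rightarrow> ('g \<Rightarrow> 'a \<rightharpoonup> 'a) \<Rightarrow> ('g \<Rightarrow> 'a \<rightharpoonup> 'a) \<Rightarrow> bool" where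
  "datum G x \<tau> A I \<gamma>\<tau> \<gamma>x \<longleftrightarrow>
    (\<forall>y\<in>objs G. rng_ideal (I y) A) \<and>
    (\<forall>y\<in>objs G. rng_isom (\<gamma>\<tau> y) (A\<lparr>carrier := I (ginv G (\<tau> y))\<rparr>) (A\<lparr>carrier := I (\<tau> y)\<rparr>)) \<and>
    group_partial_action (isotropy G x) (A\<lparr>carrier := I x\<rparr>) I \<gamma>x \<and>
    I (\<tau> x) = I x \<and> \<gamma>x x = Some |` I x \<and> \<gamma>\<tau> x = Some |` I x \<and>
    (\<forall>y\<in>objs G. rng_ideal (I (\<tau> y)) (A\<lparr>carrier := I y\<rparr>) \<and>
       rng_ideal (I (ginv G (\<tau> y))) (A\<lparr>carrier := I x\<rparr>)) \<and>
    (\<forall>g\<in>carrier G. rng_ideal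
       (pimage (\<gamma>\<tau> (tgt G g))
          (I (ginv G (\<tau> (tgt G g))) \<inter>
           pimage (\<gamma>x (loop_at G \<tau> g))
             (I (ginv G (\<tau> (src G g))) \<inter> I (ginv G (loop_at G \<tau> g)))))
       (A\<lparr>carrier := I (tgt G g)\<rparr>))"

definition conj_map ::
  "('g, 'm) arrows_scheme \<Rightarrow> ('g \<Rightarrow> 'g) \<Rightarrow> ('g \<Rightarrow> 'a \<rightharpoonup> 'a) \<Rightarrow> ('g \<Rightarrow> 'a \<rightharpoonup> 'a) \<Rightarrow> 'g \<Rightarrow> 'a \<rightharpoonup> 'a" where
  "conj_map G \<tau> \<gamma>\<tau> \<gamma>x g =
     \<gamma>\<tau> (tgt G g) \<circ>\<^sub>m \<gamma>x (loop_at G \<tau> g) \<circ>\<^sub>m pinv (\<gamma>\<tau> (src G g))"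

definition lift_map ::
  "('g, 'm) arrows_scheme \<Rightarrow> ('g \<Rightarrow> 'g) \<Rightarrow> ('g \<Rightarrow> 'a set) \<Rightarrow>
   ('g \<Rightarrow> 'a \<rightharpoonup> 'a) \<Rightarrow> ('g \<Rightarrow> 'a \<rightharpoonup> 'a) \<Rightarrow> 'g \<Rightarrow> 'a \<rightharpoonup> 'a" where
  "lift_map G \<tau> I \<gamma>\<tau> \<gamma>x g =
     (if g \<in> objs G then Some |` I g else conj_map G \<tau> \<gamma>\<tau> \<gamma>x g)"

definition lift_dom ::
  "('g, 'm) arrows_scheme \<Rightarrow> ('g \<Rightarrow> 'g) \<Rightarrow> ('g \<Rightarrow> 'a set) \<Rightarrow>
   ('g \<Rightarrow> 'a \<rightharpoonup> 'a) \<Rightarrow> ('g \<Rightarrow> 'a \<rightharpoonup> 'a) \<Rightarrow> 'g \<Rightarrow> 'a set" where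
  "lift_dom G \<tau> I \<gamma>\<tau> \<gamma>x g = ran (lift_map G \<tau> I \<gamma>\<tau> \<gamma>x g)"

text \<open>The triple \<open>(J, \<gamma>\<tau>', \<gamma>x')\<close> is a globalization in \<open>B\<close> of the datum \<open>(I, \<gamma>\<tau>, \<gamma>x)\<close>; only the
  values of \<open>J\<close> at objects matter. The ring structure of each \<open>J y\<close> is that of \<open>B\<close>.\<close>

definition datum_globalization ::
  "('g, 'm) arrows_scheme \<Rightarrow> 'g \<Rightarrow> ('g \<Rightarrow> 'g) \<Rightarrow> ('a, 'b) ring_scheme \<Rightarrow>
   ('g \<Rightarrow> 'a set) \<Rightarrow> ('g \<Rightarrow> 'a \<rightharpoonup> 'a) \<Rightarrow> ('g \<Rightarrow> 'a \<rightharpoonup> 'a) \<Rightarrow> ('a, 'c) ring_scheme \<Rightarrow>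
   ('g \<Rightarrow> 'a set) \<Rightarrow> ('g \<Rightarrow> 'a \<rightharpoonup> 'a) \<Rightarrow> ('g \<Rightarrow> 'a \<rightharpoonup> 'a) \<Rightarrow> bool" where
  "datum_globalization G x \<tau> A I \<gamma>\<tau> \<gamma>x B J \<gamma>\<tau>' \<gamma>x' \<longleftrightarrow>
    unital_rng (A\<lparr>carrier := I x\<rparr>) \<and>
    group_globalization (isotropy G x) (A\<lparr>carrier := I x\<rparr>) I \<gamma>x (B\<lparr>carrier := J x\<rparr>) \<gamma>x' \<and>
    rng B \<and>
    (\<forall>y\<in>objs G. rng_ideal (J y) B \<and>
       rng_isom (\<gamma>\<tau>' y) (B\<lparr>carrier := J x\<rparr>) (B\<lparr>carrier := J y\<rparr>) \<and>
       is_ideal_of (A\<lparr>carrier := I y\<rparr>) (B\<lparr>carrier := J y\<rparr>) \<and>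
       (\<forall>a\<in>I (ginv G (\<tau> y)). \<gamma>\<tau>' y a = \<gamma>\<tau> y a)) \<and>
    (\<forall>y\<in>objs G. I (ginv G (\<tau> y)) = I x \<and> I (\<tau> y) = I y)"

definition globalizable ::
  "('g, 'm) arrows_scheme \<Rightarrow> 'g \<Rightarrow> ('g \<Rightarrow> 'g) \<Rightarrow> ('a, 'b) ring_scheme \<Rightarrow>
   ('g \<Rightarrow> 'a set) \<Rightarrow> ('g \<Rightarrow> 'a \<rightharpoonup> 'a) \<Rightarrow> ('g \<Rightarrow> 'a \<rightharpoonup> 'a) \<Rightarrow> bool" where
  "globalizable G x \<tau> A I \<gamma>\<tau> \<gamma>x \<longleftrightarrow>
    (\<exists>(B :: 'a ring) J \<gamma>\<tau>' \<gamma>x'. datum_globalization G x \<tau> A I \<gamma>\<tau> \<gamma>x B J \<gamma>\<tau>' \<gamma>x')"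

end

(* Both the lifted partial action and the groupoid action on B arise in the same way: a partial
   action of the isotropy group at x on an ideal K x is transported along isomorphisms
   sigma_y : K x -> K y to g |-> sigma_{t(g)} o delta_{g_x} o sigma_{s(g)}^{-1}. Because g |-> g_x is a
   functor to the isotropy group, the result is a partial action of G, global if delta is. By
   condition (3), conj_map is the identity at objects also for beta, so the case distinction in
   lift_map is immaterial. Since the maps with tilde extend the ones without and send I x onto I y,
   each globalization condition is the image under sigma_{t(g)} of the one for the isotropy group;
   for the sum, g |-> g_x restricted to {g. t(g) = y} is split by h |-> tau_y h. *)
theory Submission
  imports Defs
begin

section \<open>Groupoids and transversals\<close>

context groupoid
begin

text \<open>Evaluating \<open>h \<cdot> g \<cdot> k\<close> with both bracketings shows that a left
  inverse \<open>h\<close> and a right inverse \<open>k\<close> coincide. This is what makes the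
  definite description in \<open>ginv\<close> well defined.\<close>

lemma ginv_unique:
  assumes "g \<in> carrier G"
    and "h \<in> carrier G" "src G h = tgt G g" "tgt G h = src G g" "h \<cdot> g = src G g"
    and "k \<in> carrier G" "src G k = tgt G g" "tgt G k = src G g" "g \<cdot> k = tgt G g"
  shows "h = k"
proof -
  have "h = h \<cdot> (g \<cdot> k)" using assms cmp_src by metis
  also have "\<dots> = (h \<cdot> g) \<cdot> k" using assms(1-4,6-8) by (simp add: cmp_assoc)
  also have "\<dots> = k" using assms tgt_cmp_self by metis
  finally show ?thesis .
qed

lemma ginv_eqI:
  assumes "g \<in> carrier G" "h \<in> carrier G" "src G h = tgt G g" "tgt G h = src G g"
    "h \<cdot> g = src G g" "g \<cdot> h = tgt G g"
  shows "ginv G g = h"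
  unfolding ginv_def by (rule the_equality) (use assms ginv_unique in blast)+

lemma ginv_props:
  assumes "g \<in> carrier G"
  shows ginv_closed: "ginv G g \<in> carrier G"
    and src_ginv: "src G (ginv G g) = tgt G g"
    and tgt_ginv: "tgt G (ginv G g) = src G g"
    and ginv_cmp: "ginv G g \<cdot> g = src G g"
    and cmp_ginv: "g \<cdot> ginv G g = tgt G g"
  using inverse_ex[OF assms] ginv_eqI[OF assms] by auto

lemma ginv_ginv: "g \<in> carrier G \<Longrightarrow> ginv G (ginv G g) = g"
  by (rule ginv_eqI) (simp_all add: ginv_props)

section \<open>Objects, hom-sets and the isotropy group\<close>

lemma src_objs: "g \<in> carrier G \<Longrightarrow> src G g \<in> objs G"
  and tgt_objs: "g \<in> carrier G \<Longrightarrow> tgt G g \<in> objs G"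
  by (simp_all add: objs_def src_closed tgt_closed src_src src_tgt tgt_src tgt_tgt)

lemma objsD:
  assumes "y \<in> objs G"
  shows "y \<in> carrier G" "src G y = y" "tgt G y = y"
  using assms by (auto simp: objs_def)

lemma mors_objs:
  assumes "h \<in> mors G y z"
  shows "y \<in> objs G" "z \<in> objs G"
  using assms src_objs tgt_objs by (auto simp: mors_def)

lemma cmp_mors: "g \<in> mors G y z \<Longrightarrow> h \<in> mors G w y \<Longrightarrow> g \<cdot> h \<in> mors G w z"
  by (simp add: mors_def cmp_closed src_cmp tgt_cmp)

lemma ginv_mors: "g \<in> mors G y z \<Longrightarrow> ginv G g \<in> mors G z y"
  by (simp add: mors_def ginv_props)

lemma mors_assoc:
  "g \<in> mors G y z \<Longrightarrow> h \<in> mors G w y \<Longrightarrow> k \<in> mors G v w \<Longrightarrow> g \<cdot> h \<cdot> k = g \<cdot> (h \<cdot> k)"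
  by (simp add: mors_def cmp_assoc)

lemma mors_unit:
  assumes "g \<in> mors G y z"
  shows "g \<cdot> y = g" "z \<cdot> g = g"
  using assms cmp_src[of g] tgt_cmp_self[of g] by (auto simp: mors_def)

lemma mors_ginv_cmp:
  assumes "g \<in> mors G y z"
  shows "ginv G g \<cdot> g = y" "g \<cdot> ginv G g = z"
  using assms by (auto simp: mors_def ginv_props)

lemma mors_cmp_ginv_cancel:
  assumes "g \<in> mors G y z" "k \<in> mors G w z"
  shows "g \<cdot> (ginv G g \<cdot> k) = k"
  using mors_assoc[OF assms(1) ginv_mors[OF assms(1)] assms(2), symmetric]
  by (simp add: mors_ginv_cmp[OF assms(1)] mors_unit[OF assms(2)])

text \<open>Passing to \<open>isotropy G x\<close> changes only the carrier, and the endpoint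
  conditions already force an inverse of a loop to be a loop, so both definite descriptions have the
  same predicate.\<close>

lemma ginv_isotropy:
  assumes "h \<in> mors G x x"
  shows "ginv (isotropy G x) h = ginv G h"
  unfolding ginv_def
  by (rule arg_cong[where f = The]) (use assms in \<open>auto simp: isotropy_def mors_def\<close>)

section \<open>The functor to the isotropy group defined by a transversal\<close>

context
  fixes x \<tau>
  assumes transversal: "transversal G x \<tau>"
begin

lemma transversal_mors: "y \<in> objs G \<Longrightarrow> \<tau> y \<in> mors G x y"
  using transversal by (simp add: transversal_def)

lemma loop_at_eq:
  "g \<in> mors G y z \<Longrightarrow> loop_at G \<tau> g = ginv G (\<tau> z) \<cdot> g \<cdot> \<tau> y"
  by (auto simp: loop_at_def mors_def)

lemma loop_at_mors: "g \<in> mors G y z \<Longrightarrow> loop_at G \<tau> g \<in> mors G x x"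
  using mors_objs[of g y z]
  by (auto simp: loop_at_eq intro!: cmp_mors ginv_mors transversal_mors)

lemma loop_at_obj: "y \<in> objs G \<Longrightarrow> loop_at G \<tau> y = x"
proof -
  assume y: "y \<in> objs G"
  note ty = transversal_mors[OF y]
  have "y \<in> mors G y y" using y by (simp add: mors_def objsD)
  from loop_at_eq[OF this] show ?thesis
    by (simp add: mors_unit[OF ginv_mors[OF ty]] mors_ginv_cmp[OF ty])
qed

text \<open>The inner factors \<open>\<tau> y\<close> and \<open>ginv G (\<tau> y)\<close> cancel.
  Together with \<open>loop_at_obj\<close> this makes \<open>loop_at G \<tau>\<close> a functor to
  the isotropy group.\<close>

lemma loop_at_cmp:
  assumes g: "g \<in> mors G y z" and h: "h \<in> mors G w y"
  shows "loop_at G \<tau> (g \<cdot> h) = loop_at G \<tau> g \<cdot> loop_at G \<tau> h"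
proof -
  have tz: "\<tau> z \<in> mors G x z" and ty: "\<tau> y \<in> mors G x y" and tw: "\<tau> w \<in> mors G x w"
    using mors_objs[OF g] mors_objs[OF h] transversal_mors by auto
  note iz = ginv_mors[OF tz] and iy = ginv_mors[OF ty]
  have gty: "g \<cdot> \<tau> y \<in> mors G x z" and htw: "h \<cdot> \<tau> w \<in> mors G x y"
    using g h ty tw by (auto intro: cmp_mors)
  have lh: "loop_at G \<tau> h = ginv G (\<tau> y) \<cdot> (h \<cdot> \<tau> w)"
    using mors_assoc[OF iy h tw] by (simp add: loop_at_eq[OF h])
  have mh: "ginv G (\<tau> y) \<cdot> (h \<cdot> \<tau> w) \<in> mors G x x" using cmp_mors[OF iy htw] .
  have "loop_at G \<tau> g \<cdot> loop_at G \<tau> h = ginv G (\<tau> z) \<cdot> (g \<cdot> \<tau> y) \<cdot> loop_at G \<tau> h"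
    by (simp only: mors_assoc[OF iz g ty] loop_at_eq[OF g])
  also have "\<dots> = ginv G (\<tau> z) \<cdot> (g \<cdot> (\<tau> y \<cdot> (ginv G (\<tau> y) \<cdot> (h \<cdot> \<tau> w))))"
    by (simp only: lh mors_assoc[OF iz gty mh] mors_assoc[OF g ty mh])
  also have "\<dots> = ginv G (\<tau> z) \<cdot> (g \<cdot> (h \<cdot> \<tau> w))"
    by (simp only: mors_cmp_ginv_cancel[OF ty htw])
  also have "\<dots> = loop_at G \<tau> (g \<cdot> h)"
    by (simp only: mors_assoc[OF g h tw] mors_assoc[OF iz cmp_mors[OF g h] tw]
        loop_at_eq[OF cmp_mors[OF g h]])
  finally show ?thesis by simp
qed

text \<open>A functor preserves inverses: apply \<open>loop_at_cmp\<close> to the two composites of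
  \<open>g\<close> with its inverse, which are objects and hence go to \<open>x\<close>.\<close>

lemma loop_at_ginv:
  assumes g: "g \<in> mors G y z"
  shows "loop_at G \<tau> (ginv G g) = ginv G (loop_at G \<tau> g)"
proof -
  note l = loop_at_mors[OF g] loop_at_mors[OF ginv_mors[OF g]]
  have "loop_at G \<tau> (ginv G g) \<cdot> loop_at G \<tau> g = x" "loop_at G \<tau> g \<cdot> loop_at G \<tau> (ginv G g) = x"
    using loop_at_cmp[OF g ginv_mors[OF g]] loop_at_cmp[OF ginv_mors[OF g] g] mors_objs[OF g]
    by (simp_all add: mors_ginv_cmp[OF g] loop_at_obj)
  then show ?thesis
    using l by (intro ginv_eqI[symmetric]) (auto simp: mors_def)
qed

text \<open>The normalization \<open>\<tau> x = x\<close> enters here. Thus every loop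
  \<open>h\<close> is the loop of an arrow with a prescribed target \<open>y\<close>, which later
  allows sums over loops to be rewritten as sums over arrows into \<open>y\<close>.\<close>

lemma loop_at_transversal_cmp:
  assumes y: "y \<in> objs G" and h: "h \<in> mors G x x"
  shows "loop_at G \<tau> (\<tau> y \<cdot> h) = h"
proof -
  note ty = transversal_mors[OF y]
  have "\<tau> x = x" using transversal by (simp add: transversal_def)
  then have "loop_at G \<tau> (\<tau> y \<cdot> h) = ginv G (\<tau> y) \<cdot> (\<tau> y \<cdot> h) \<cdot> x"
    using loop_at_eq[OF cmp_mors[OF ty h]] by simp
  also have "\<dots> = h"
    using mors_assoc[OF ginv_mors[OF ty] ty h] h
    by (simp add: mors_ginv_cmp[OF ty] mors_unit)
  finally show ?thesis .
qed

end

end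


section \<open>Partial bijections and rings without unit\<close>

text \<open>The order is inclusion of graphs; in this form partial maps are compared one pair at a
  time.\<close>

lemma map_le_iff: "m \<subseteq>\<^sub>m n \<longleftrightarrow> (\<forall>a b. m a = Some b \<longrightarrow> n a = Some b)"
proof
  assume le: "m \<subseteq>\<^sub>m n"
  show "\<forall>a b. m a = Some b \<longrightarrow> n a = Some b"
  proof (intro allI impI)
    fix a b assume m: "m a = Some b"
    from bspec[OF le[unfolded map_le_def] domI[of m, OF m]] m show "n a = Some b" by simp
  qed
next
  assume *: "\<forall>a b. m a = Some b \<longrightarrow> n a = Some b"
  show "m \<subseteq>\<^sub>m n" unfolding map_le_def
  proof
    fix a assume "a \<in> dom m"
    then obtain b where "m a = Some b" by auto
    with * have "n a = Some b" by blast
    with \<open>m a = Some b\<close> show "m a = n a" by simp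
  qed
qed

lemma restrict_eq_Some_iff: "(m |` S) a = Some b \<longleftrightarrow> a \<in> S \<and> m a = Some b"
  by (auto simp: restrict_map_def)

lemma pimage_iff: "b \<in> pimage m S \<longleftrightarrow> (\<exists>a\<in>S. m a = Some b)"
  by (auto simp: pimage_def ran_def restrict_eq_Some_iff)

text \<open>Injectivity makes the definite description in \<open>pinv\<close> unambiguous, so the
  graph of \<open>pinv m\<close> is the converse of the graph of \<open>m\<close>.\<close>

lemma pinv_eq_Some_iff:
  assumes "inj_on m (dom m)"
  shows "pinv m b = Some a \<longleftrightarrow> m a = Some b"
proof -
  have the: "(THE a. m a = Some b) = a'" if a': "m a' = Some b" for a'
  proof (rule the_equality)
    show "m a' = Some b" by (rule a')
    fix a assume "m a = Some b"
    then show "a = a'" using inj_onD[OF assms] a' by (metis domI)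
  qed
  show ?thesis
  proof
    assume "m a = Some b"
    with the[OF this] ranI[of m, OF this] show "pinv m b = Some a"
      by (simp add: pinv_def)
  next
    assume *: "pinv m b = Some a"
    then have "b \<in> ran m" by (simp add: pinv_def split: if_splits)
    then obtain a' where a': "m a' = Some b" unfolding ran_def by blast
    with * the[OF a'] ranI[of m, OF a'] have "a = a'" by (simp add: pinv_def)
    with a' show "m a = Some b" by simp
  qed
qed

section \<open>Ring isomorphisms as partial maps\<close>

lemma rng_isom_bij:
  assumes "rng_isom m R S"
  shows "dom m = carrier R" "ran m = carrier S" "inj_on m (dom m)"
  using assms unfolding rng_isom_def by blast+

lemma rng_isom_total:
  assumes "rng_isom m R S" "a \<in> carrier R"
  obtains b where "m a = Some b" "b \<in> carrier S"
proof -
  have "a \<in> dom m" using assms(2) rng_isom_bij(1)[OF assms(1)] by simp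
  then show ?thesis using that ranI rng_isom_bij(2)[OF assms(1)] by fastforce
qed

lemma rng_isom_onto:
  assumes "rng_isom m R S" "b \<in> carrier S"
  obtains a where "m a = Some b" "a \<in> carrier R"
proof -
  have "b \<in> ran m" using assms(2) rng_isom_bij(2)[OF assms(1)] by simp
  then show ?thesis using that rng_isom_bij(1)[OF assms(1)] by (fastforce simp: ran_def)
qed

lemma rng_isom_SomeD:
  assumes "rng_isom m R S" "m a = Some b"
  shows "a \<in> carrier R" "b \<in> carrier S"
  using domI[of m, OF assms(2)] ranI[of m, OF assms(2)] rng_isom_bij[OF assms(1)] by simp_all

lemma rng_isom_inj:
  assumes "rng_isom m R S" "m a = Some c" "m b = Some c"
  shows "a = b"
  using inj_onD[OF rng_isom_bij(3)[OF assms(1)] _ domI[of m, OF assms(2)] domI[of m, OF assms(3)]] assms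
  by simp

lemma rng_isom_add:
  assumes "rng_isom m R S" "m a = Some a'" "m b = Some b'"
  shows "m (a \<oplus>\<^bsub>R\<^esub> b) = Some (a' \<oplus>\<^bsub>S\<^esub> b')"
  using assms unfolding rng_isom_def by blast

lemma rng_isom_mult:
  assumes "rng_isom m R S" "m a = Some a'" "m b = Some b'"
  shows "m (a \<otimes>\<^bsub>R\<^esub> b) = Some (a' \<otimes>\<^bsub>S\<^esub> b')"
  using assms unfolding rng_isom_def by blast

lemma pimage_cong:
  assumes "\<And>a. a \<in> S \<Longrightarrow> m a = n a"
  shows "pimage m S = pimage n S"
proof -
  have "m |` S = n |` S" using assms by (auto simp: restrict_map_def)
  then show ?thesis by (simp add: pimage_def)
qed

text \<open>By injectivity, the preimages of a common value found in \<open>S\<close> and in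
  \<open>T\<close> are the same element.\<close>

lemma pimage_Int:
  assumes "rng_isom m R R'"
  shows "pimage m (S \<inter> T) = pimage m S \<inter> pimage m T"
proof (rule equalityI; rule subsetI)
  fix b assume "b \<in> pimage m S \<inter> pimage m T"
  then obtain a a' where "a \<in> S" "m a = Some b" "a' \<in> T" "m a' = Some b"
    unfolding Int_iff pimage_iff by blast
  moreover from this have "a = a'" using rng_isom_inj[OF assms] by blast
  ultimately show "b \<in> pimage m (S \<inter> T)" unfolding pimage_iff by blast
next
  fix b assume "b \<in> pimage m (S \<inter> T)"
  then show "b \<in> pimage m S \<inter> pimage m T" unfolding Int_iff pimage_iff by blast
qed

text \<open>\<open>rng_isom\<close> speaks only of sums and products. The image \<open>z\<close> of
  zero satisfies \<open>z + z = z\<close>, and adding the negative of \<open>z\<close> gives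
  zero.\<close>

lemma rng_isom_zero:
  assumes m: "rng_isom m R S" and "rng R" "rng S"
  shows "m \<zero>\<^bsub>R\<^esub> = Some \<zero>\<^bsub>S\<^esub>"
proof -
  interpret R: abelian_group R using assms by (simp add: rng_def)
  interpret S: abelian_group S using assms by (simp add: rng_def)
  obtain z where z: "m \<zero>\<^bsub>R\<^esub> = Some z" "z \<in> carrier S"
    by (rule rng_isom_total[OF m R.zero_closed])
  have "Some z = m (\<zero>\<^bsub>R\<^esub> \<oplus>\<^bsub>R\<^esub> \<zero>\<^bsub>R\<^esub>)" by (simp add: z(1))
  also have "\<dots> = Some (z \<oplus>\<^bsub>S\<^esub> z)" by (rule rng_isom_add[OF m z(1) z(1)])
  finally have zz: "z \<oplus>\<^bsub>S\<^esub> z = z" by (metis option.inject)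
  have "z = \<ominus>\<^bsub>S\<^esub> z \<oplus>\<^bsub>S\<^esub> (z \<oplus>\<^bsub>S\<^esub> z)" using z(2) by (simp add: S.r_neg1)
  also have "\<dots> = \<zero>\<^bsub>S\<^esub>" unfolding zz using z(2) by (rule S.l_neg)
  finally show ?thesis using z(1) by simp
qed

lemma rng_isom_a_inv:
  assumes m: "rng_isom m R S" and "rng R" "rng S" and a: "m a = Some b"
  shows "m (\<ominus>\<^bsub>R\<^esub> a) = Some (\<ominus>\<^bsub>S\<^esub> b)"
proof -
  interpret R: abelian_group R using assms by (simp add: rng_def)
  interpret S: abelian_group S using assms by (simp add: rng_def)
  note c = rng_isom_SomeD[OF m a]
  obtain z where z: "m (\<ominus>\<^bsub>R\<^esub> a) = Some z" "z \<in> carrier S"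
    by (rule rng_isom_total[OF m R.a_inv_closed[OF c(1)]])
  have "Some (z \<oplus>\<^bsub>S\<^esub> b) = m (\<ominus>\<^bsub>R\<^esub> a \<oplus>\<^bsub>R\<^esub> a)"
    by (rule rng_isom_add[OF m z(1) a, symmetric])
  also have "\<dots> = Some \<zero>\<^bsub>S\<^esub>" unfolding R.l_neg[OF c(1)] by (rule rng_isom_zero[OF assms(1-3)])
  finally have "z \<oplus>\<^bsub>S\<^esub> b = \<zero>\<^bsub>S\<^esub>" by (simp only: option.inject)
  from S.minus_equality[OF this c(2) z(2)] show ?thesis by (simp only: z(1))
qed

section \<open>Ideals and finite sums\<close>

lemma rng_idealD:
  assumes "rng_ideal S R"
  shows "rng R" "S \<subseteq> carrier R" "\<zero>\<^bsub>R\<^esub> \<in> S"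
    and "\<And>a b. a \<in> S \<Longrightarrow> b \<in> S \<Longrightarrow> a \<oplus>\<^bsub>R\<^esub> b \<in> S"
    and "\<And>a. a \<in> S \<Longrightarrow> \<ominus>\<^bsub>R\<^esub> a \<in> S"
    and "\<And>a r. a \<in> S \<Longrightarrow> r \<in> carrier R \<Longrightarrow> r \<otimes>\<^bsub>R\<^esub> a \<in> S"
    and "\<And>a r. a \<in> S \<Longrightarrow> r \<in> carrier R \<Longrightarrow> a \<otimes>\<^bsub>R\<^esub> r \<in> S"
proof -
  interpret additive_subgroup S R using assms by (simp add: rng_ideal_def)
  show "rng R" using assms by (simp add: rng_ideal_def)
  show "S \<subseteq> carrier R" by (rule a_subset)
  show "\<zero>\<^bsub>R\<^esub> \<in> S" by (rule zero_closed)
  show "a \<oplus>\<^bsub>R\<^esub> b \<in> S" if "a \<in> S" "b \<in> S" for a b using that by (rule a_closed)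
  show "\<ominus>\<^bsub>R\<^esub> a \<in> S" if "a \<in> S" for a
    using that by (rule a_inv_closed)
  show "r \<otimes>\<^bsub>R\<^esub> a \<in> S" "a \<otimes>\<^bsub>R\<^esub> r \<in> S" if "a \<in> S" "r \<in> carrier R" for a r
    using that assms by (auto simp: rng_ideal_def)
qed

lemma rng_idealI:
  assumes R: "rng R" and "S \<subseteq> carrier R" "\<zero>\<^bsub>R\<^esub> \<in> S"
    and "\<And>a b. a \<in> S \<Longrightarrow> b \<in> S \<Longrightarrow> a \<oplus>\<^bsub>R\<^esub> b \<in> S"
    and "\<And>a. a \<in> S \<Longrightarrow> \<ominus>\<^bsub>R\<^esub> a \<in> S"
    and "\<And>a r. a \<in> S \<Longrightarrow> r \<in> carrier R \<Longrightarrow> r \<otimes>\<^bsub>R\<^esub> a \<in> S"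
    and "\<And>a r. a \<in> S \<Longrightarrow> r \<in> carrier R \<Longrightarrow> a \<otimes>\<^bsub>R\<^esub> r \<in> S"
  shows "rng_ideal S R"
proof -
  interpret abelian_group R using R by (simp add: rng_def)
  have "subgroup S (add_monoid R)"
    using assms by (intro add.subgroupI) (auto simp: a_inv_def)
  then show ?thesis
    using assms by (simp add: rng_ideal_def additive_subgroup_def)
qed

lemma rng_ideal_rng:
  assumes S: "rng_ideal S R"
  shows "rng (R\<lparr>carrier := S\<rparr>)"
proof -
  note I = rng_idealD[OF S]
  interpret abelian_group R using I(1) by (simp add: rng_def)
  have sub: "a \<in> carrier R" if "a \<in> S" for a
    using I(2) that by auto
  have "abelian_group (R\<lparr>carrier := S\<rparr>)"
  proof (rule abelian_groupI)
    fix a assume "a \<in> carrier (R\<lparr>carrier := S\<rparr>)"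
    then show "\<exists>b\<in>carrier (R\<lparr>carrier := S\<rparr>). b \<oplus>\<^bsub>R\<lparr>carrier := S\<rparr>\<^esub> a = \<zero>\<^bsub>R\<lparr>carrier := S\<rparr>\<^esub>"
      by (intro bexI[of _ "\<ominus>\<^bsub>R\<^esub> a"]) (simp_all add: l_neg I(5) sub)
  qed (simp_all add: I(3,4) a_ac sub)
  then show ?thesis
    using I(1) by (simp add: rng_def I(6) sub)
qed

text \<open>Absorption uses surjectivity: a multiplier \<open>r\<close> in \<open>S\<close> has a
  preimage \<open>s\<close>, and products with \<open>r\<close> are images of products with
  \<open>s\<close>.\<close>

lemma rng_ideal_pimage:
  assumes m: "rng_isom m R S" and S: "rng S" and T: "rng_ideal T R"
  shows "rng_ideal (pimage m T) S"
proof -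
  note I = rng_idealD[OF T]
  show ?thesis
  proof (rule rng_idealI[OF S])
    show "pimage m T \<subseteq> carrier S"
      using rng_isom_SomeD(2)[OF m] by (auto simp: pimage_iff)
    show "\<zero>\<^bsub>S\<^esub> \<in> pimage m T"
      using rng_isom_zero[OF m I(1) S] I(3) by (auto simp: pimage_iff)
    show "a \<oplus>\<^bsub>S\<^esub> b \<in> pimage m T" if "a \<in> pimage m T" "b \<in> pimage m T" for a b
      using that by (auto simp: pimage_iff dest: rng_isom_add[OF m] I(4))
    show "\<ominus>\<^bsub>S\<^esub> a \<in> pimage m T" if "a \<in> pimage m T" for a
      using that by (auto simp: pimage_iff dest: rng_isom_a_inv[OF m I(1) S] I(5))
    show "r \<otimes>\<^bsub>S\<^esub> a \<in> pimage m T" "a \<otimes>\<^bsub>S\<^esub> r \<in> pimage m T"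
      if a: "a \<in> pimage m T" and r: "r \<in> carrier S" for a r
    proof -
      obtain c where c: "c \<in> T" "m c = Some a" using a by (auto simp: pimage_iff)
      obtain s where s: "m s = Some r" "s \<in> carrier R" using rng_isom_onto[OF m r] .
      show "r \<otimes>\<^bsub>S\<^esub> a \<in> pimage m T" "a \<otimes>\<^bsub>S\<^esub> r \<in> pimage m T"
        using rng_isom_mult[OF m s(1) c(2)] rng_isom_mult[OF m c(2) s(1)] I(6,7)[OF c(1) s(2)]
        by (auto simp: pimage_iff)
    qed
  qed
qed

text \<open>Induction on the index set, for a total function \<open>u\<close> that is controlled
  only on the carrier of \<open>R\<close>. Having two rings allows a sum formed in an ideal to
  become a sum formed in a whole ring.\<close>

lemma finsum_hom:
  assumes "abelian_group R" "abelian_group S" "finite K"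
    and u0: "u \<zero>\<^bsub>R\<^esub> = \<zero>\<^bsub>S\<^esub>"
    and uc: "\<And>a. a \<in> carrier R \<Longrightarrow> u a \<in> carrier S"
    and ua: "\<And>a b. a \<in> carrier R \<Longrightarrow> b \<in> carrier R \<Longrightarrow> u (a \<oplus>\<^bsub>R\<^esub> b) = u a \<oplus>\<^bsub>S\<^esub> u b"
    and f: "f ` K \<subseteq> carrier R"
  shows "u (finsum R f K) = finsum S (\<lambda>i. u (f i)) K"
proof -
  interpret R: abelian_group R by fact
  interpret S: abelian_group S by fact
  show ?thesis using \<open>finite K\<close> f
  proof (induction K rule: finite_induct)
    case (insert i K)
    then have "f \<in> K \<rightarrow> carrier R" "f i \<in> carrier R" by auto
    moreover from this have "(\<lambda>i. u (f i)) \<in> K \<rightarrow> carrier S" "u (f i) \<in> carrier S"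
      using uc by auto
    ultimately show ?case
      using insert by (simp add: ua)
  qed (simp add: u0)
qed

text \<open>An ideal contains zero and is closed under addition, so it contains each finite sum by
  induction on the index set.\<close>

lemma ideal_sum_subset:
  assumes "abelian_group R" and "rng_ideal S R" and "\<And>i. i \<in> K \<Longrightarrow> F i \<subseteq> S"
  shows "ideal_sum R K F \<subseteq> S"
proof
  interpret abelian_group R by fact
  fix a assume "a \<in> ideal_sum R K F"
  then obtain L f where a: "a = finsum R f L" and "finite L" "L \<subseteq> K" "\<forall>i\<in>L. f i \<in> F i"
    unfolding ideal_sum_def by blast
  then have "finite L" "f ` L \<subseteq> S" using assms(3) by auto
  then show "a \<in> S" unfolding a
  proof (induction L rule: finite_induct)
    case empty
    then show ?case using rng_idealD(3)[OF assms(2)] by simp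
  next
    case (insert i L)
    moreover from this have "f \<in> L \<rightarrow> carrier R" "f i \<in> carrier R"
      using rng_idealD(2)[OF assms(2)] by auto
    ultimately show ?case using rng_idealD(4)[OF assms(2)] by simp
  qed
qed


section \<open>Transport of a partial action along a transversal\<close>

text \<open>The common frame for \<beta> and its globalization, interpreted once over
  \<open>A\<close> and once over \<open>B\<close>. \<open>K\<close> gives the ideals at objects,
  \<open>D\<close> the ideals of the partial action of the isotropy group. Each
  \<open>\<sigma> y\<close> is defined on all of \<open>K x\<close> and onto \<open>K y\<close>, as
  condition (3) on a globalizable datum provides.\<close>

locale isotropy_action = groupoid G for G (structure) +
  fixes x :: 'g and \<tau> :: "'g \<Rightarrow> 'g"
    and R :: "('a, 'b) ring_scheme" and K :: "'g \<Rightarrow> 'a set" and \<sigma> :: "'g \<Rightarrow> 'a \<rightharpoonup> 'a"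
    and D :: "'g \<Rightarrow> 'a set" and \<delta> :: "'g \<Rightarrow> 'a \<rightharpoonup> 'a"
  assumes x_objs: "x \<in> objs G"
    and transversal: "transversal G x \<tau>"
    and ideal_K: "\<And>y. y \<in> objs G \<Longrightarrow> rng_ideal (K y) R"
    and isom_\<sigma>: "\<And>y. y \<in> objs G \<Longrightarrow> rng_isom (\<sigma> y) (R\<lparr>carrier := K x\<rparr>) (R\<lparr>carrier := K y\<rparr>)"
    and action: "partial_action (isotropy G x) (R\<lparr>carrier := K x\<rparr>) D \<delta>"
    and D_x: "D x = K x"
begin

abbreviation lp :: "'g \<Rightarrow> 'g" where "lp \<equiv> loop_at G \<tau>"
abbreviation cj :: "'g \<Rightarrow> 'a \<rightharpoonup> 'a" where "cj \<equiv> conj_map G \<tau> \<sigma> \<delta>"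

lemma carrier_mors: "g \<in> carrier G \<Longrightarrow> g \<in> mors G (src G g) (tgt G g)"
  by (simp add: mors_def)

lemma lp_mors: "g \<in> carrier G \<Longrightarrow> lp g \<in> mors G x x"
  by (rule loop_at_mors[OF transversal carrier_mors])

lemma lp_ginv: "g \<in> carrier G \<Longrightarrow> lp (ginv G g) = ginv G (lp g)"
  by (rule loop_at_ginv[OF transversal carrier_mors])

lemma lp_cmp:
  "g \<in> carrier G \<Longrightarrow> h \<in> carrier G \<Longrightarrow> src G g = tgt G h \<Longrightarrow> lp (g \<cdot> h) = lp g \<cdot> lp h"
  by (rule loop_at_cmp[OF transversal, of _ "tgt G h"]) (simp_all add: mors_def)

text \<open>Translates the action axioms from the isotropy record to the operations of
  \<open>G\<close>; every loop has target \<open>x\<close>, where \<open>D\<close> equals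
  \<open>K x\<close>.\<close>

lemma isotropy_action_props:
  assumes "h \<in> mors G x x"
  shows ideal_D: "rng_ideal (D h) (R\<lparr>carrier := K x\<rparr>)"
    and isom_\<delta>: "rng_isom (\<delta> h) (R\<lparr>carrier := D (ginv G h)\<rparr>) (R\<lparr>carrier := D h\<rparr>)"
proof -
  have h: "h \<in> carrier (isotropy G x)" "tgt (isotropy G x) h = x"
    using assms by (simp_all add: isotropy_def mors_def)
  note p = action[unfolded partial_action_def, THEN conjunct2, THEN conjunct1, rule_format, OF h(1)]
  show "rng_ideal (D h) (R\<lparr>carrier := K x\<rparr>)"
    using p by (simp add: h(2) D_x)
  show "rng_isom (\<delta> h) (R\<lparr>carrier := D (ginv G h)\<rparr>) (R\<lparr>carrier := D h\<rparr>)"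
    using p by (simp add: ginv_isotropy[OF assms])
qed

lemma \<delta>_x: "\<delta> x = Some |` K x"
proof -
  have "x \<in> objs (isotropy G x)"
    using objsD[OF x_objs] by (simp add: objs_def isotropy_def mors_def)
  then show ?thesis using action by (simp add: partial_action_def D_x)
qed

lemma \<delta>_cmp: "h \<in> mors G x x \<Longrightarrow> k \<in> mors G x x \<Longrightarrow> \<delta> h \<circ>\<^sub>m \<delta> k \<subseteq>\<^sub>m \<delta> (h \<cdot> k)"
  using action by (simp add: partial_action_def isotropy_def mors_def)

lemma D_subset: "h \<in> mors G x x \<Longrightarrow> D h \<subseteq> K x"
  using rng_idealD(2)[OF ideal_D] by simp

text \<open>Since \<open>b\<close> lies in \<open>D h\<close>, the domain of the map at the inverse,
  the composite of the two maps is defined at \<open>a\<close>. It is a restriction of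
  \<open>\<delta> x\<close>, the identity of \<open>K x\<close>.\<close>

lemma \<delta>_ginv:
  assumes h: "h \<in> mors G x x" and ab: "\<delta> h a = Some b"
  shows "\<delta> (ginv G h) b = Some a"
proof -
  note h' = ginv_mors[OF h]
  have hc: "h \<in> carrier G" using h by (simp add: mors_def)
  have "b \<in> D h" using rng_isom_SomeD(2)[OF isom_\<delta>[OF h] ab] by simp
  then have "b \<in> carrier (R\<lparr>carrier := D (ginv G (ginv G h))\<rparr>)" by (simp add: ginv_ginv[OF hc])
  then obtain c where c: "\<delta> (ginv G h) b = Some c"
    by (rule rng_isom_total[OF isom_\<delta>[OF h']])
  with ab have "(\<delta> (ginv G h) \<circ>\<^sub>m \<delta> h) a = Some c" by simp
  with \<delta>_cmp[OF h' h] have "\<delta> x a = Some c"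
    unfolding map_le_iff mors_ginv_cmp(1)[OF h] by blast
  then have "c = a" by (simp add: \<delta>_x restrict_eq_Some_iff)
  with c show ?thesis by simp
qed

section \<open>Graphs, ranges and inverses of the conjugated maps\<close>

lemma pinv_\<sigma>: "y \<in> objs G \<Longrightarrow> pinv (\<sigma> y) b = Some a \<longleftrightarrow> \<sigma> y a = Some b"
  by (rule pinv_eq_Some_iff[OF rng_isom_bij(3)[OF isom_\<sigma>]])

text \<open>Unfolds the threefold composite into a chain \<open>a\<close>, \<open>c\<close>,
  \<open>d\<close>, \<open>b\<close> whose middle points lie over \<open>x\<close>. The facts about
  \<open>cj\<close> below are obtained by manipulating such chains.\<close>

lemma conj_map_iff:
  assumes "g \<in> carrier G"
  shows "cj g a = Some b \<longleftrightarrow>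
    (\<exists>c d. \<sigma> (src G g) c = Some a \<and> \<delta> (lp g) c = Some d \<and> \<sigma> (tgt G g) d = Some b)"
  unfolding conj_map_def map_comp_Some_iff pinv_\<sigma>[OF src_objs[OF assms]] by blast

lemma \<sigma>_total:
  assumes "y \<in> objs G" "a \<in> K x"
  obtains b where "\<sigma> y a = Some b" "b \<in> K y"
  using rng_isom_total[OF isom_\<sigma>[OF assms(1)], of a] assms(2) by auto

text \<open>The range is cut down only by the middle factor: every \<open>c\<close> in the domain of
  \<open>\<delta> (lp g)\<close> lies in \<open>K x\<close>, hence in the domain of
  \<open>\<sigma> (src G g)\<close>, and so starts a chain.\<close>

lemma conj_map_ran:
  assumes g: "g \<in> carrier G"
  shows "ran (cj g) = pimage (\<sigma> (tgt G g)) (D (lp g))"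
proof (rule equalityI; rule subsetI)
  fix b assume "b \<in> ran (cj g)"
  then obtain a where "cj g a = Some b" unfolding ran_def by blast
  then obtain c d where d: "\<delta> (lp g) c = Some d" "\<sigma> (tgt G g) d = Some b"
    unfolding conj_map_iff[OF g] by blast
  then have "d \<in> D (lp g)" using rng_isom_SomeD(2)[OF isom_\<delta>[OF lp_mors[OF g]]] by simp
  with d show "b \<in> pimage (\<sigma> (tgt G g)) (D (lp g))" unfolding pimage_iff by blast
next
  fix b assume "b \<in> pimage (\<sigma> (tgt G g)) (D (lp g))"
  then obtain d where d: "d \<in> D (lp g)" "\<sigma> (tgt G g) d = Some b" unfolding pimage_iff by blast
  from d(1) have "d \<in> carrier (R\<lparr>carrier := D (lp g)\<rparr>)" by simp
  then obtain c where c: "\<delta> (lp g) c = Some d" "c \<in> carrier (R\<lparr>carrier := D (ginv G (lp g))\<rparr>)"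
    by (rule rng_isom_onto[OF isom_\<delta>[OF lp_mors[OF g]]])
  then have "c \<in> K x" using D_subset[OF ginv_mors[OF lp_mors[OF g]]] by auto
  then obtain a where "\<sigma> (src G g) c = Some a" by (rule \<sigma>_total[OF src_objs[OF g]])
  with c d have "cj g a = Some b" unfolding conj_map_iff[OF g] by blast
  then show "b \<in> ran (cj g)" by (rule ranI)
qed

text \<open>Read the chain backwards: source and target are exchanged, \<open>lp\<close> commutes
  with inversion, and \<open>\<delta>_ginv\<close> reverses the middle link.\<close>

lemma conj_map_ginv:
  assumes g: "g \<in> carrier G" and "cj g a = Some b"
  shows "cj (ginv G g) b = Some a"
proof -
  obtain c d where "\<sigma> (src G g) c = Some a" "\<delta> (lp g) c = Some d" "\<sigma> (tgt G g) d = Some b"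
    using assms(2) unfolding conj_map_iff[OF g] by blast
  then show ?thesis
    using \<delta>_ginv[OF lp_mors[OF g]]
    unfolding conj_map_iff[OF ginv_closed[OF g]] lp_ginv[OF g] src_ginv[OF g] tgt_ginv[OF g] by blast
qed

lemma conj_map_dom:
  assumes g: "g \<in> carrier G"
  shows "dom (cj g) = ran (cj (ginv G g))"
proof (rule equalityI; rule subsetI)
  fix a assume "a \<in> dom (cj g)"
  then obtain b where "cj g a = Some b" by blast
  from conj_map_ginv[OF g this] show "a \<in> ran (cj (ginv G g))" by (rule ranI)
next
  fix a assume "a \<in> ran (cj (ginv G g))"
  then obtain b where "cj (ginv G g) b = Some a" unfolding ran_def by blast
  from conj_map_ginv[OF ginv_closed[OF g] this] show "a \<in> dom (cj g)"
    unfolding ginv_ginv[OF g] by (rule domI)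
qed

text \<open>Injectivity follows from the inverse map \<open>cj (ginv G g)\<close>; sums and products
  are preserved because two chains can be added and multiplied link by link.\<close>

lemma conj_map_isom:
  assumes g: "g \<in> carrier G"
  shows "rng_isom (cj g) (R\<lparr>carrier := ran (cj (ginv G g))\<rparr>) (R\<lparr>carrier := ran (cj g)\<rparr>)"
  unfolding rng_isom_def
proof (intro conjI allI impI)
  show "dom (cj g) = carrier (R\<lparr>carrier := ran (cj (ginv G g))\<rparr>)"
    using conj_map_dom[OF g] by simp
  show "inj_on (cj g) (dom (cj g))"
  proof (rule inj_onI)
    fix a a' assume "a \<in> dom (cj g)" and eq: "cj g a = cj g a'"
    then obtain b where b: "cj g a = Some b" by blast
    with eq have "cj g a' = Some b" by simp
    from conj_map_ginv[OF g b] conj_map_ginv[OF g this] show "a = a'" by simp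
  qed
next
  fix a b a' b' assume "cj g a = Some a'" "cj g b = Some b'"
  then obtain c d c' d' where
    c: "\<sigma> (src G g) c = Some a" "\<delta> (lp g) c = Some d" "\<sigma> (tgt G g) d = Some a'" and
    c': "\<sigma> (src G g) c' = Some b" "\<delta> (lp g) c' = Some d'" "\<sigma> (tgt G g) d' = Some b'"
    unfolding conj_map_iff[OF g] by blast
  note s = isom_\<sigma>[OF src_objs[OF g]] and t = isom_\<sigma>[OF tgt_objs[OF g]]
    and l = isom_\<delta>[OF lp_mors[OF g]]
  show "cj g (a \<oplus>\<^bsub>R\<lparr>carrier := ran (cj (ginv G g))\<rparr>\<^esub> b) = Some (a' \<oplus>\<^bsub>R\<lparr>carrier := ran (cj g)\<rparr>\<^esub> b')"
    using rng_isom_add[OF s c(1) c'(1)] rng_isom_add[OF l c(2) c'(2)] rng_isom_add[OF t c(3) c'(3)]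
    unfolding conj_map_iff[OF g] ring.simps by auto
  show "cj g (a \<otimes>\<^bsub>R\<lparr>carrier := ran (cj (ginv G g))\<rparr>\<^esub> b) = Some (a' \<otimes>\<^bsub>R\<lparr>carrier := ran (cj g)\<rparr>\<^esub> b')"
    using rng_isom_mult[OF s c(1) c'(1)] rng_isom_mult[OF l c(2) c'(2)] rng_isom_mult[OF t c(3) c'(3)]
    unfolding conj_map_iff[OF g] ring.simps by auto
qed simp

section \<open>Conjugated maps at objects and their composition\<close>

lemma pimage_\<sigma>: "y \<in> objs G \<Longrightarrow> pimage (\<sigma> y) (K x) = K y"
proof -
  assume y: "y \<in> objs G"
  have "dom (\<sigma> y) = K x" "ran (\<sigma> y) = K y"
    using rng_isom_bij(1,2)[OF isom_\<sigma>[OF y]] by simp_all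
  then have "b \<in> pimage (\<sigma> y) (K x) \<longleftrightarrow> b \<in> K y" for b
    using domI[of "\<sigma> y"] unfolding pimage_iff ran_def by blast
  then show ?thesis by blast
qed

lemma lp_obj: "y \<in> objs G \<Longrightarrow> lp y = x"
  by (rule loop_at_obj[OF transversal])

text \<open>The loop of an object is \<open>x\<close>, where \<open>\<delta>\<close> is the identity
  of \<open>K x\<close>. What remains is \<open>\<sigma> y\<close> after its inverse, which is the
  identity of all of \<open>K y\<close> because \<open>\<sigma> y\<close> is onto.\<close>

lemma conj_map_obj:
  assumes y: "y \<in> objs G"
  shows "cj y = Some |` K y"
proof (rule map_le_antisym)
  have yc: "y \<in> carrier G" by (rule objsD[OF y])
  have iff: "cj y a = Some b \<longleftrightarrow> (\<exists>c d. \<sigma> y c = Some a \<and> (c \<in> K x \<and> c = d) \<and> \<sigma> y d = Some b)" for a b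
    unfolding conj_map_iff[OF yc] lp_obj[OF y] objsD[OF y] \<delta>_x restrict_eq_Some_iff by auto
  show "cj y \<subseteq>\<^sub>m Some |` K y"
    using rng_isom_SomeD(2)[OF isom_\<sigma>[OF y]]
    unfolding map_le_iff iff restrict_eq_Some_iff by auto
  show "Some |` K y \<subseteq>\<^sub>m cj y"
    unfolding map_le_iff
  proof (intro allI impI)
    fix a b assume "(Some |` K y) a = Some b"
    then have ab: "b = a" and a: "a \<in> carrier (R\<lparr>carrier := K y\<rparr>)"
      unfolding restrict_eq_Some_iff by auto
    from a obtain c where "\<sigma> y c = Some a" "c \<in> carrier (R\<lparr>carrier := K x\<rparr>)"
      by (rule rng_isom_onto[OF isom_\<sigma>[OF y]])
    then show "cj y a = Some b" unfolding iff ab by auto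
  qed
qed

text \<open>The chains for \<open>h\<close> and \<open>g\<close> meet over the object
  \<open>tgt G h\<close>; injectivity of \<open>\<sigma>\<close> there identifies their neighbouring
  points over \<open>x\<close>, and functoriality of \<open>lp\<close> joins the middle
  links.\<close>

lemma conj_map_cmp:
  assumes g: "g \<in> carrier G" and h: "h \<in> carrier G" and gh: "src G g = tgt G h"
  shows "cj g \<circ>\<^sub>m cj h \<subseteq>\<^sub>m cj (g \<cdot> h)"
  unfolding map_le_iff
proof (intro allI impI)
  fix a b assume "(cj g \<circ>\<^sub>m cj h) a = Some b"
  then obtain e where "cj h a = Some e" "cj g e = Some b" unfolding map_comp_Some_iff by blast
  then obtain c d c' d' where
    c: "\<sigma> (src G h) c = Some a" "\<delta> (lp h) c = Some d" "\<sigma> (tgt G h) d = Some e" and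
    c': "\<sigma> (tgt G h) c' = Some e" "\<delta> (lp g) c' = Some d'" "\<sigma> (tgt G g) d' = Some b"
    unfolding conj_map_iff[OF g] conj_map_iff[OF h] gh by blast
  have "c' = d" by (rule rng_isom_inj[OF isom_\<sigma>[OF tgt_objs[OF h]] c'(1) c(3)])
  with c c' have "(\<delta> (lp g) \<circ>\<^sub>m \<delta> (lp h)) c = Some d'" by simp
  then have "\<delta> (lp g \<cdot> lp h) c = Some d'"
    using \<delta>_cmp[OF lp_mors[OF g] lp_mors[OF h]] unfolding map_le_iff by blast
  with c c' show "cj (g \<cdot> h) a = Some b"
    unfolding conj_map_iff[OF cmp_closed[OF g h gh]] src_cmp[OF g h gh] tgt_cmp[OF g h gh]
      lp_cmp[OF g h gh] by blast
qed

text \<open>For the reverse inclusion, globality splits the middle link of a chain for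
  \<open>g \<cdot> h\<close> at a point \<open>e\<close> of \<open>K x\<close>.\<close>

lemma conj_map_cmp_global:
  assumes g: "g \<in> carrier G" and h: "h \<in> carrier G" and gh: "src G g = tgt G h"
    and global: "\<delta> (lp g) \<circ>\<^sub>m \<delta> (lp h) = \<delta> (lp g \<cdot> lp h)"
  shows "cj g \<circ>\<^sub>m cj h = cj (g \<cdot> h)"
proof (rule map_le_antisym[OF conj_map_cmp[OF g h gh]])
  show "cj (g \<cdot> h) \<subseteq>\<^sub>m cj g \<circ>\<^sub>m cj h"
    unfolding map_le_iff
  proof (intro allI impI)
    fix a b assume "cj (g \<cdot> h) a = Some b"
    then obtain c d where c: "\<sigma> (src G h) c = Some a"
      "(\<delta> (lp g) \<circ>\<^sub>m \<delta> (lp h)) c = Some d" "\<sigma> (tgt G g) d = Some b"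
      unfolding conj_map_iff[OF cmp_closed[OF g h gh]] src_cmp[OF g h gh] tgt_cmp[OF g h gh]
        lp_cmp[OF g h gh] global by blast
    from c(2) obtain e where e: "\<delta> (lp h) c = Some e" "\<delta> (lp g) e = Some d"
      unfolding map_comp_Some_iff by blast
    have "e \<in> K x"
      using rng_isom_SomeD(2)[OF isom_\<delta>[OF lp_mors[OF h]] e(1)] D_subset[OF lp_mors[OF h]] by auto
    \<comment> \<open>The lift \<open>f\<close> of \<open>e\<close> to the object
      \<open>tgt G h\<close> is the intermediate value of the composite.\<close>
    then obtain f where f: "\<sigma> (tgt G h) e = Some f" by (rule \<sigma>_total[OF tgt_objs[OF h]])
    have "cj h a = Some f" using c e f unfolding conj_map_iff[OF h] by blast
    moreover have "cj g f = Some b" using c e f unfolding conj_map_iff[OF g] gh by blast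
    ultimately show "(cj g \<circ>\<^sub>m cj h) a = Some b" by simp
  qed
qed

text \<open>\<open>\<alpha>\<close> and \<open>E\<close> are prescribed only on arrows, so that both
  \<open>lift_map\<close> with \<open>lift_dom\<close> and the family \<open>J (tgt G g)\<close>
  fit.\<close>

lemma conj_map_partial_action:
  assumes \<alpha>: "\<And>g. g \<in> carrier G \<Longrightarrow> \<alpha> g = cj g"
    and E: "\<And>g. g \<in> carrier G \<Longrightarrow> E g = ran (cj g)"
  shows "partial_action G R E \<alpha>"
proof -
  have E_obj: "E y = K y" if "y \<in> objs G" for y
    using that objsD[OF that] pimage_\<sigma>[OF that]
    by (simp add: E conj_map_ran lp_obj D_x)
  \<comment> \<open>\<open>D (lp g)\<close> is an ideal of \<open>K x\<close>, and the isomorphism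
    \<open>\<sigma> (tgt G g)\<close> carries it to an ideal of \<open>K (tgt G g)\<close>.\<close>
  have ideal: "rng_ideal (E g) (R\<lparr>carrier := E (tgt G g)\<rparr>)" if g: "g \<in> carrier G" for g
    unfolding E[OF g] conj_map_ran[OF g] E_obj[OF tgt_objs[OF g]]
    using isom_\<sigma>[OF tgt_objs[OF g]] rng_ideal_rng[OF ideal_K[OF tgt_objs[OF g]]]
      ideal_D[OF lp_mors[OF g]]
    by (rule rng_ideal_pimage)
  show ?thesis unfolding partial_action_def
  proof (intro conjI ballI impI)
    show "rng R" by (rule rng_idealD(1)[OF ideal_K[OF x_objs]])
  next
    fix g assume g: "g \<in> carrier G"
    show "rng_ideal (E (tgt G g)) R"
      using ideal_K[OF tgt_objs[OF g]] by (simp add: E_obj tgt_objs[OF g])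
    show "rng_ideal (E g) (R\<lparr>carrier := E (tgt G g)\<rparr>)" by (rule ideal[OF g])
    show "rng_isom (\<alpha> g) (R\<lparr>carrier := E (ginv G g)\<rparr>) (R\<lparr>carrier := E g\<rparr>)"
      unfolding \<alpha>[OF g] E[OF g] E[OF ginv_closed[OF g]] by (rule conj_map_isom[OF g])
  next
    fix y assume "y \<in> objs G"
    then show "\<alpha> y = Some |` E y" by (simp add: \<alpha> objsD conj_map_obj E_obj)
  next
    fix g h assume g: "g \<in> carrier G" and h: "h \<in> carrier G" and gh: "src G g = tgt G h"
    show "\<alpha> g \<circ>\<^sub>m \<alpha> h \<subseteq>\<^sub>m \<alpha> (g \<cdot> h)"
      unfolding \<alpha>[OF g] \<alpha>[OF h] \<alpha>[OF cmp_closed[OF g h gh]] by (rule conj_map_cmp[OF g h gh])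
  qed
qed

text \<open>The inverse of \<open>\<sigma> (src G g)\<close> inside \<open>cj g\<close> undoes the
  inner image; \<open>T\<close> lies in \<open>K x\<close>, so no point of \<open>T\<close> is lost
  on the way.\<close>

lemma conj_map_pimage:
  assumes g: "g \<in> carrier G" and T: "T \<subseteq> K x"
  shows "pimage (cj g) (pimage (\<sigma> (src G g)) T) = pimage (\<sigma> (tgt G g)) (pimage (\<delta> (lp g)) T)"
proof (rule equalityI; rule subsetI)
  fix b assume "b \<in> pimage (cj g) (pimage (\<sigma> (src G g)) T)"
  then obtain a c where c: "c \<in> T" "\<sigma> (src G g) c = Some a" and "cj g a = Some b"
    unfolding pimage_iff Bex_def by blast
  then obtain c' d where c': "\<sigma> (src G g) c' = Some a"
    and d: "\<delta> (lp g) c' = Some d" "\<sigma> (tgt G g) d = Some b"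
    unfolding conj_map_iff[OF g] by blast
  have "c' = c" by (rule rng_isom_inj[OF isom_\<sigma>[OF src_objs[OF g]] c' c(2)])
  with c d show "b \<in> pimage (\<sigma> (tgt G g)) (pimage (\<delta> (lp g)) T)"
    unfolding pimage_iff Bex_def by blast
next
  fix b assume "b \<in> pimage (\<sigma> (tgt G g)) (pimage (\<delta> (lp g)) T)"
  then obtain c d where c: "c \<in> T" "\<delta> (lp g) c = Some d" "\<sigma> (tgt G g) d = Some b"
    unfolding pimage_iff Bex_def by blast
  have "c \<in> K x" using T c(1) by blast
  then obtain a where a: "\<sigma> (src G g) c = Some a" by (rule \<sigma>_total[OF src_objs[OF g]])
  with c have "cj g a = Some b" unfolding conj_map_iff[OF g] by blast
  with a c(1) show "b \<in> pimage (cj g) (pimage (\<sigma> (src G g)) T)"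
    unfolding pimage_iff Bex_def by blast
qed

text \<open>Pull an element of \<open>K y\<close> back to \<open>K x\<close>, decompose it into
  summands indexed by loops, push the summands forward by \<open>\<sigma> y\<close>, and index them
  by arrows into \<open>y\<close> instead.\<close>

lemma ideal_sum_transport:
  assumes y: "y \<in> objs G" and sum: "K x = ideal_sum (R\<lparr>carrier := K x\<rparr>) (mors G x x) F"
    and F: "\<And>h. h \<in> mors G x x \<Longrightarrow> F h \<subseteq> K x"
    and P: "\<And>g. g \<in> carrier G \<Longrightarrow> tgt G g = y \<Longrightarrow> P g = pimage (\<sigma> y) (F (lp g))"
  shows "K y = ideal_sum R {g \<in> carrier G. tgt G g = y} P"
proof (rule equalityI)
  have R: "abelian_group R"
    using rng_idealD(1)[OF ideal_K[OF x_objs]] by (simp add: rng_def)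
  show "ideal_sum R {g \<in> carrier G. tgt G g = y} P \<subseteq> K y"
  proof (rule ideal_sum_subset[OF R ideal_K[OF y]])
    fix g assume "g \<in> {g \<in> carrier G. tgt G g = y}"
    then have "P g = pimage (\<sigma> y) (F (lp g))" by (simp add: P)
    then show "P g \<subseteq> K y"
      using rng_isom_SomeD(2)[OF isom_\<sigma>[OF y]] by (auto simp: pimage_iff)
  qed
  show "K y \<subseteq> ideal_sum R {g \<in> carrier G. tgt G g = y} P"
  proof
    fix z assume "z \<in> K y"
    then have "z \<in> carrier (R\<lparr>carrier := K y\<rparr>)" by simp
    then obtain w where w: "\<sigma> y w = Some z" "w \<in> carrier (R\<lparr>carrier := K x\<rparr>)"
      by (rule rng_isom_onto[OF isom_\<sigma>[OF y]])
    from w(2) have "w \<in> ideal_sum (R\<lparr>carrier := K x\<rparr>) (mors G x x) F" using sum by simp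
    then obtain L f where wf: "w = finsum (R\<lparr>carrier := K x\<rparr>) f L"
      and L: "finite L" "L \<subseteq> mors G x x" and f: "\<forall>h\<in>L. f h \<in> F h"
      unfolding ideal_sum_def by blast
    \<comment> \<open>A total version of \<open>\<sigma> y\<close>, as \<open>finsum\<close> takes
      total functions; the arbitrary values of \<open>the\<close> outside \<open>K x\<close> never
      enter the sums.\<close>
    define u where "u = (\<lambda>a. the (\<sigma> y a))"
    have u: "\<sigma> y a = Some (u a)" "u a \<in> carrier R" if a: "a \<in> K x" for a
    proof -
      obtain b where b: "\<sigma> y a = Some b" "b \<in> K y" by (rule \<sigma>_total[OF y a])
      then show "\<sigma> y a = Some (u a)" "u a \<in> carrier R"
        using rng_idealD(2)[OF ideal_K[OF y]] by (auto simp: u_def)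
    qed
    have fL: "f h \<in> K x" if "h \<in> L" for h using f F L(2) that by blast
    \<comment> \<open>The new index of the loop \<open>h\<close> is an arrow from \<open>x\<close>
      to \<open>y\<close> whose loop is again \<open>h\<close>; in particular \<open>e\<close> is
      injective.\<close>
    define e where "e = (\<lambda>h. \<tau> y \<cdot> h)"
    have lp_e: "lp (e h) = h" if "h \<in> L" for h
      unfolding e_def by (rule loop_at_transversal_cmp[OF transversal y]) (use L that in blast)
    have e: "e h \<in> mors G x y" if "h \<in> L" for h
      unfolding e_def by (rule cmp_mors[OF transversal_mors[OF transversal y]]) (use L that in blast)
    have inj: "inj_on e L" by (rule inj_on_inverseI[where g = lp]) (rule lp_e)
    have rngs: "rng (R\<lparr>carrier := K x\<rparr>)" "rng (R\<lparr>carrier := K y\<rparr>)"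
      by (rule rng_ideal_rng[OF ideal_K[OF x_objs]], rule rng_ideal_rng[OF ideal_K[OF y]])
    have "z = u w" using w by (simp add: u_def)
    also have "\<dots> = finsum R (\<lambda>h. u (f h)) L"
      unfolding wf
    proof (rule finsum_hom[OF _ R L(1)])
      show "abelian_group (R\<lparr>carrier := K x\<rparr>)" using rngs(1) by (simp add: rng_def)
      show "u \<zero>\<^bsub>R\<lparr>carrier := K x\<rparr>\<^esub> = \<zero>\<^bsub>R\<^esub>"
        using rng_isom_zero[OF isom_\<sigma>[OF y] rngs] by (simp add: u_def)
      show "u a \<in> carrier R" if "a \<in> carrier (R\<lparr>carrier := K x\<rparr>)" for a
        using that u(2) by simp
      show "u (a \<oplus>\<^bsub>R\<lparr>carrier := K x\<rparr>\<^esub> b) = u a \<oplus>\<^bsub>R\<^esub> u b"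
        if "a \<in> carrier (R\<lparr>carrier := K x\<rparr>)" "b \<in> carrier (R\<lparr>carrier := K x\<rparr>)" for a b
      proof -
        have "a \<in> K x" "b \<in> K x" using that by simp_all
        from rng_isom_add[OF isom_\<sigma>[OF y] u(1)[OF this(1)] u(1)[OF this(2)]] show ?thesis
          by (simp add: u_def)
      qed
      show "f ` L \<subseteq> carrier (R\<lparr>carrier := K x\<rparr>)" using fL by auto
    qed
    \<comment> \<open>Writing \<open>h\<close> as \<open>lp (e h)\<close> turns the summand into a
      function of \<open>e h\<close>, ready for reindexing along \<open>e\<close>.\<close>
    also have "\<dots> = finsum R (\<lambda>h. u (f (lp (e h)))) L"
      by (rule abelian_monoid.finsum_cong'[OF abelian_group.axioms(1)[OF R]])
        (use fL u(2) lp_e in auto)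
    also have "\<dots> = finsum R (\<lambda>g. u (f (lp g))) (e ` L)"
      by (rule abelian_monoid.finsum_reindex[OF abelian_group.axioms(1)[OF R] _ inj, symmetric])
        (use fL u(2) lp_e in auto)
    finally have z: "z = finsum R (\<lambda>g. u (f (lp g))) (e ` L)" .
    have "u (f (lp g)) \<in> P g \<and> g \<in> {g \<in> carrier G. tgt G g = y}" if ge: "g \<in> e ` L" for g
    proof -
      obtain h where h: "h \<in> L" "g = e h" using ge by blast
      have g: "g \<in> carrier G" "tgt G g = y" using e[OF h(1)] h(2) by (auto simp: mors_def)
      have "f h \<in> F h" using f h(1) by blast
      then have "u (f h) \<in> pimage (\<sigma> y) (F h)"
        using u(1)[OF fL[OF h(1)]] unfolding pimage_iff by blast
      moreover have "lp g = h" using lp_e[OF h(1)] h(2) by simp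
      ultimately show ?thesis using g by (simp add: P[OF g])
    qed
    then have "\<forall>g\<in>e ` L. u (f (lp g)) \<in> P g" "e ` L \<subseteq> {g \<in> carrier G. tgt G g = y}" by blast+
    then show "z \<in> ideal_sum R {g \<in> carrier G. tgt G g = y} P"
      using z finite_imageI[OF L(1), of e] unfolding ideal_sum_def by blast
  qed
qed

end


section \<open>Globalization\<close>

lemma globalizationD:
  assumes "globalization G A D \<alpha> A' D' \<alpha>'"
  shows "partial_action G A D \<alpha>" and "global_action G A' D' \<alpha>'"
    and "\<And>g. g \<in> carrier G \<Longrightarrow> D g = D (tgt G g) \<inter> pimage (\<alpha>' g) (D (src G g))"
    and "\<And>g a. g \<in> carrier G \<Longrightarrow> a \<in> D (ginv G g) \<Longrightarrow> \<alpha>' g a = \<alpha> g a"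
    and "\<And>g. g \<in> carrier G \<Longrightarrow> D' g =
      ideal_sum A' {h \<in> carrier G. tgt G h = tgt G g} (\<lambda>h. pimage (\<alpha>' h) (D (src G h)))"
proof -
  note d = assms[unfolded globalization_def]
  note d3 = d[THEN conjunct2, THEN conjunct2, THEN conjunct2]
  show "partial_action G A D \<alpha>" by (rule d[THEN conjunct1])
  show "global_action G A' D' \<alpha>'" by (rule d[THEN conjunct2, THEN conjunct1])
  show "D g = D (tgt G g) \<inter> pimage (\<alpha>' g) (D (src G g))" if "g \<in> carrier G" for g
    by (rule bspec[OF d3[THEN conjunct1] that])
  show "\<alpha>' g a = \<alpha> g a" if "g \<in> carrier G" "a \<in> D (ginv G g)" for g a
    by (rule bspec[OF bspec[OF d3[THEN conjunct2, THEN conjunct1] that(1)] that(2)])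
  show "D' g =
      ideal_sum A' {h \<in> carrier G. tgt G h = tgt G g} (\<lambda>h. pimage (\<alpha>' h) (D (src G h)))"
    if "g \<in> carrier G" for g
    by (rule bspec[OF d3[THEN conjunct2, THEN conjunct2] that])
qed

theorem theorem4p3:
  fixes G :: "'g arrows" and x :: 'g and \<tau> :: "'g \<Rightarrow> 'g"
    and A B :: "'a ring"
    and I J :: "'g \<Rightarrow> 'a set"
    and \<gamma>\<tau> \<gamma>x \<gamma>\<tau>' \<gamma>x' :: "'g \<Rightarrow> 'a \<rightharpoonup> 'a"
  assumes "groupoid G" and "connected_groupoid G" and "x \<in> objs G" and "transversal G x \<tau>"
    and "rng A"
    and "datum G x \<tau> A I \<gamma>\<tau> \<gamma>x"
    and "globalizable G x \<tau> A I \<gamma>\<tau> \<gamma>x"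
    and "datum_globalization G x \<tau> A I \<gamma>\<tau> \<gamma>x B J \<gamma>\<tau>' \<gamma>x'"
  shows "globalization G
           A (lift_dom G \<tau> I \<gamma>\<tau> \<gamma>x) (lift_map G \<tau> I \<gamma>\<tau> \<gamma>x)
           B (\<lambda>g. J (tgt G g)) (conj_map G \<tau> \<gamma>\<tau>' \<gamma>x')"
proof -
  interpret groupoid G by fact
  let ?H = "isotropy G x" and ?Ax = "A\<lparr>carrier := I x\<rparr>" and ?Bx = "B\<lparr>carrier := J x\<rparr>"
  note dat = \<open>datum G x \<tau> A I \<gamma>\<tau> \<gamma>x\<close>[unfolded datum_def]
    and glob = \<open>datum_globalization G x \<tau> A I \<gamma>\<tau> \<gamma>x B J \<gamma>\<tau>' \<gamma>x'\<close>[unfolded datum_globalization_def]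
  have "group_globalization ?H ?Ax I \<gamma>x ?Bx \<gamma>x'" using glob by blast
  then have globalization_x: "globalization ?H ?Ax I \<gamma>x ?Bx (\<lambda>_. J x) \<gamma>x'"
    by (simp add: group_globalization_def)
  have global_x: "global_action ?H ?Bx (\<lambda>_. J x) \<gamma>x'"
    by (rule globalizationD(2)[OF globalization_x])
  \<comment> \<open>By condition (3), each \<open>\<gamma>\<tau> y\<close> is an isomorphism from
    the whole of \<open>I x\<close> onto the whole of \<open>I y\<close>.\<close>
  have I_full: "I (ginv G (\<tau> y)) = I x" "I (\<tau> y) = I y" if "y \<in> objs G" for y
    using glob that by blast+
  have ext: "\<gamma>\<tau>' y a = \<gamma>\<tau> y a" if "y \<in> objs G" "a \<in> I x" for y a
  proof -
    have "\<forall>a\<in>I (ginv G (\<tau> y)). \<gamma>\<tau>' y a = \<gamma>\<tau> y a" using glob that(1) by blast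
    then show ?thesis using that(2) unfolding I_full[OF that(1)] by blast
  qed
  \<comment> \<open>The instance giving \<beta>. The family \<open>I\<close> serves both as
    \<open>K\<close>, at objects, and as \<open>D\<close>, at loops.\<close>
  interpret a: isotropy_action G x \<tau> A I \<gamma>\<tau> I \<gamma>x
  proof unfold_locales
    fix y assume y: "y \<in> objs G"
    show "rng_ideal (I y) A" using dat y by blast
    have "rng_isom (\<gamma>\<tau> y) (A\<lparr>carrier := I (ginv G (\<tau> y))\<rparr>) (A\<lparr>carrier := I (\<tau> y)\<rparr>)"
      using dat y by blast
    then show "rng_isom (\<gamma>\<tau> y) ?Ax (A\<lparr>carrier := I y\<rparr>)" unfolding I_full[OF y] .
  qed (rule assms globalizationD(1)[OF globalization_x] refl)+
  \<comment> \<open>The instance giving the action on \<open>B\<close>. The action of the isotropy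
    group is global here, so \<open>D\<close> is constantly \<open>J x\<close>.\<close>
  interpret b: isotropy_action G x \<tau> B J \<gamma>\<tau>' "\<lambda>_. J x" \<gamma>x'
  proof unfold_locales
    fix y assume y: "y \<in> objs G"
    show "rng_ideal (J y) B" "rng_isom (\<gamma>\<tau>' y) ?Bx (B\<lparr>carrier := J y\<rparr>)"
      using glob y by blast+
  qed (rule assms global_x[unfolded global_action_def, THEN conjunct1] refl)+
  have isoE: "h \<in> carrier ?H \<longleftrightarrow> h \<in> mors G x x" "src ?H = src G" "tgt ?H = tgt G" "cmp ?H = cmp G" for h
    by (simp_all add: isotropy_def)
  \<comment> \<open>The extension, intersection and sum conditions of the group globalization
    follow, expressed by the operations of \<open>G\<close>.\<close>
  have x_ext: "\<gamma>x' h c = \<gamma>x h c" if h: "h \<in> mors G x x" and c: "c \<in> I (ginv G h)" for h c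
    by (rule globalizationD(4)[OF globalization_x])
      (simp_all only: isoE h c ginv_isotropy[OF h])
  have x_int: "I h = I x \<inter> pimage (\<gamma>x' h) (I x)" if h: "h \<in> mors G x x" for h
  proof -
    have "src G h = x" "tgt G h = x" using h by (simp_all add: mors_def)
    with globalizationD(3)[OF globalization_x, unfolded isoE, OF h] show ?thesis by (simp only:)
  qed
  have x_sum: "J x = ideal_sum ?Bx (mors G x x) (\<lambda>h. pimage (\<gamma>x' h) (I (src G h)))"
  proof -
    have x: "x \<in> mors G x x" and "{h. h \<in> mors G x x \<and> tgt G h = tgt G x} = mors G x x"
      using objsD[OF a.x_objs] by (auto simp: mors_def)
    with globalizationD(5)[OF globalization_x, unfolded isoE, OF x] show ?thesis by (simp only:)
  qed
  have J_ideal: "is_ideal_of (A\<lparr>carrier := I y\<rparr>) (B\<lparr>carrier := J y\<rparr>)" if "y \<in> objs G" for y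
    using glob that by blast
  have I_x_sub: "I x \<subseteq> J x"
    using J_ideal[OF a.x_objs] rng_idealD(2)[of "I x" ?Bx] by (simp add: is_ideal_of_def)
  have lift: "lift_map G \<tau> I \<gamma>\<tau> \<gamma>x g = a.cj g" if "g \<in> carrier G" for g
    using a.conj_map_obj[of g] by (simp add: lift_map_def)
  have ldom: "lift_dom G \<tau> I \<gamma>\<tau> \<gamma>x g = ran (a.cj g)" if "g \<in> carrier G" for g
    by (simp add: lift_dom_def lift[OF that])
  have ldom_obj: "lift_dom G \<tau> I \<gamma>\<tau> \<gamma>x y = I y" if "y \<in> objs G" for y
    using that objsD[OF that] a.pimage_\<sigma>[OF that]
    by (simp add: ldom a.conj_map_ran a.lp_obj)
  have \<sigma>_ext: "\<gamma>\<tau>' y c = Some a" if "y \<in> objs G" "\<gamma>\<tau> y c = Some a" for y c a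
    using rng_isom_SomeD(1)[OF a.isom_\<sigma>[OF that(1)] that(2)] ext[OF that(1), of c] that(2) by simp
  have \<sigma>_img: "pimage (\<gamma>\<tau>' y) S = pimage (\<gamma>\<tau> y) S" if "y \<in> objs G" "S \<subseteq> I x" for y S
    by (rule pimage_cong) (use ext[OF that(1)] that(2) in blast)
  have I_img: "pimage (\<gamma>\<tau>' y) (I x) = I y" if "y \<in> objs G" for y
    using \<sigma>_img[OF that] a.pimage_\<sigma>[OF that] by simp
  \<comment> \<open>Each of the three factors with a prime extends the one without, so a chain for
    \<open>a.cj g\<close> is also a chain for \<open>b.cj g\<close>.\<close>
  have cj_ext: "b.cj g a = Some b" if g: "g \<in> carrier G" and ab: "a.cj g a = Some b" for g a b
  proof -
    obtain c d where c: "\<gamma>\<tau> (src G g) c = Some a" "\<gamma>x (a.lp g) c = Some d" "\<gamma>\<tau> (tgt G g) d = Some b"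
      using ab unfolding a.conj_map_iff[OF g] by blast
    have "c \<in> I (ginv G (a.lp g))"
      using rng_isom_SomeD(1)[OF a.isom_\<delta>[OF a.lp_mors[OF g]] c(2)] by simp
    then have "\<gamma>x' (a.lp g) c = Some d" using x_ext[OF a.lp_mors[OF g]] c(2) by simp
    then show ?thesis
      using \<sigma>_ext[OF src_objs[OF g] c(1)] \<sigma>_ext[OF tgt_objs[OF g] c(3)]
      unfolding b.conj_map_iff[OF g] by blast
  qed
  \<comment> \<open>\<open>conj_map_pimage\<close> for \<open>T = I x\<close>, whose image under
    \<open>\<gamma>\<tau>' (src G g)\<close> is \<open>I (src G g)\<close>.\<close>
  have cj_img: "pimage (b.cj g) (I (src G g)) = pimage (\<gamma>\<tau>' (tgt G g)) (pimage (\<gamma>x' (a.lp g)) (I x))"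
    if g: "g \<in> carrier G" for g
    using b.conj_map_pimage[OF g I_x_sub] unfolding I_img[OF src_objs[OF g]] .
  have b_ran: "ran (b.cj g) = J (tgt G g)" if g: "g \<in> carrier G" for g
    using b.conj_map_ran[OF g] b.pimage_\<sigma>[OF tgt_objs[OF g]] by simp
  have b_partial: "partial_action G B (\<lambda>g. J (tgt G g)) b.cj"
    by (rule b.conj_map_partial_action) (simp_all add: b_ran)
  have b_global: "b.cj g \<circ>\<^sub>m b.cj h = b.cj (g \<cdot>\<^bsub>G\<^esub> h)"
    if g: "g \<in> carrier G" and h: "h \<in> carrier G" and gh: "src G g = tgt G h" for g h
  proof (rule b.conj_map_cmp_global[OF g h gh])
    show "\<gamma>x' (a.lp g) \<circ>\<^sub>m \<gamma>x' (a.lp h) = \<gamma>x' (a.lp g \<cdot>\<^bsub>G\<^esub> a.lp h)"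
      by (rule global_x[unfolded global_action_def isoE, THEN conjunct2, rule_format])
        (use a.lp_mors[OF g] a.lp_mors[OF h] in \<open>simp_all add: mors_def isotropy_def\<close>)
  qed
  \<comment> \<open>The image under \<open>\<gamma>\<tau>' (tgt G g)\<close> of the intersection
    condition at the loop of \<open>g\<close>; being injective, this map commutes with the
    intersection.\<close>
  have inter: "ran (a.cj g) = I (tgt G g) \<inter> pimage (b.cj g) (I (src G g))"
    if g: "g \<in> carrier G" for g
  proof -
    note t = tgt_objs[OF g] and l = a.lp_mors[OF g]
    have "ran (a.cj g) = pimage (\<gamma>\<tau>' (tgt G g)) (I (a.lp g))"
      unfolding a.conj_map_ran[OF g] by (rule \<sigma>_img[OF t a.D_subset[OF l], symmetric])
    also have "\<dots> = pimage (\<gamma>\<tau>' (tgt G g)) (I x \<inter> pimage (\<gamma>x' (a.lp g)) (I x))"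
      unfolding x_int[OF l, symmetric] ..
    also have "\<dots> = I (tgt G g) \<inter> pimage (b.cj g) (I (src G g))"
      unfolding cj_img[OF g] pimage_Int[OF b.isom_\<sigma>[OF t]] I_img[OF t] ..
    finally show ?thesis .
  qed
  \<comment> \<open>Transport of \<open>x_sum\<close>: by \<open>cj_img\<close>, the summand at an
    arrow \<open>g\<close> into \<open>y\<close> is the image under \<open>\<gamma>\<tau>' y\<close>
    of the summand at its loop.\<close>
  have sum: "J y = ideal_sum B {h \<in> carrier G. tgt G h = y}
      (\<lambda>h. pimage (b.cj h) (lift_dom G \<tau> I \<gamma>\<tau> \<gamma>x (src G h)))" if y: "y \<in> objs G" for y
  proof (rule b.ideal_sum_transport[OF y x_sum])
    show "pimage (\<gamma>x' h) (I (src G h)) \<subseteq> J x" if "h \<in> mors G x x" for h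
      using rng_isom_SomeD(2)[OF b.isom_\<delta>[OF that]] by (auto simp: pimage_iff)
    show "pimage (b.cj g) (lift_dom G \<tau> I \<gamma>\<tau> \<gamma>x (src G g)) =
        pimage (\<gamma>\<tau>' y) (pimage (\<gamma>x' (a.lp g)) (I (src G (a.lp g))))"
      if g: "g \<in> carrier G" and "tgt G g = y" for g
    proof -
      have "src G (a.lp g) = x" using a.lp_mors[OF g] by (simp add: mors_def)
      with cj_img[OF g] that(2) show ?thesis by (simp add: ldom_obj src_objs[OF g])
    qed
  qed
  show ?thesis unfolding globalization_def
  proof (intro conjI ballI)
    show "partial_action G A (lift_dom G \<tau> I \<gamma>\<tau> \<gamma>x) (lift_map G \<tau> I \<gamma>\<tau> \<gamma>x)"
      by (rule a.conj_map_partial_action) (simp_all add: lift ldom)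
    show "global_action G B (\<lambda>g. J (tgt G g)) b.cj"
      unfolding global_action_def using b_partial b_global by blast
  next
    fix y assume y: "y \<in> objs G"
    then show "is_ideal_of (A\<lparr>carrier := lift_dom G \<tau> I \<gamma>\<tau> \<gamma>x y\<rparr>) (B\<lparr>carrier := J (tgt G y)\<rparr>)"
      using J_ideal[OF y] by (simp add: ldom_obj objsD)
  next
    fix g assume g: "g \<in> carrier G"
    show "lift_dom G \<tau> I \<gamma>\<tau> \<gamma>x g =
      lift_dom G \<tau> I \<gamma>\<tau> \<gamma>x (tgt G g) \<inter> pimage (b.cj g) (lift_dom G \<tau> I \<gamma>\<tau> \<gamma>x (src G g))"
      unfolding ldom[OF g] ldom_obj[OF src_objs[OF g]] ldom_obj[OF tgt_objs[OF g]]
      by (rule inter[OF g])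
    show "b.cj g a = lift_map G \<tau> I \<gamma>\<tau> \<gamma>x g a" if "a \<in> lift_dom G \<tau> I \<gamma>\<tau> \<gamma>x (ginv G g)" for a
    proof -
      \<comment> \<open>The domain of the lifted map at \<open>g\<close> is its range at the inverse
        of \<open>g\<close>, so the lifted map has a value at \<open>a\<close> and
        \<open>cj_ext\<close> applies.\<close>
      have "a \<in> dom (a.cj g)"
        using that unfolding ldom[OF ginv_closed[OF g]] a.conj_map_dom[OF g] .
      then obtain b where "a.cj g a = Some b" by blast
      with cj_ext[OF g this] show ?thesis by (simp add: lift[OF g])
    qed
    show "J (tgt G g) = ideal_sum B {h \<in> carrier G. tgt G h = tgt G g}
        (\<lambda>h. pimage (b.cj h) (lift_dom G \<tau> I \<gamma>\<tau> \<gamma>x (src G h)))"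
      by (rule sum[OF tgt_objs[OF g]])
  qed
qed

end
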